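(* Let $\mathbb{F}_q$ have characteristic $p\neq 2$, let $d,s$ be integers with $1\le s\le d-3$, and let $\boldsymbol{a}=(a_{d-1},\dots,a_{d-s})\in\overline{\mathbb{F}}_q^{\,s}$. Let $B_{d-s-1},\dots,B_1,B_0,T$ be indeterminates over $\overline{\mathbb{F}}_q$ and $$f:=T^d+a_{d-1}T^{d-1}+\cdots+a_{d-s}T^{d-s}+B_{d-s-1}T^{d-s-1}+\cdots+B_1T+B_0\in\overline{\mathbb{F}}_q[B_{d-s-1},\dots,B_0,T].$$ Then the discriminant $\mathrm{Disc}(f)$ of $f$ with respect to $T$ is an irreducible polynomial of $\overline{\mathbb{F}}_q[B_{d-s-1},\dots,B_1,B_0]$.
   Context: $\overline{\mathbb{F}}_q$ denotes an algebraic closure of $\mathbb{F}_q$. *)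

theory Defs
  imports
    "HOL-Library.Poly_Mapping"
    "HOL-Algebra.Algebraic_Closure_Type"
    "HOL-Algebra.Ring_Divisibility"
    "Subresultants.Resultant_Prelim"
begin

text \<open>Monomials in the indeterminates \<open>B\<^sub>0, B\<^sub>1, \<dots>\<close> are finitely supported exponent
  functions, and polynomials are finitely supported functions from monomials to coefficients;
  ring operations (convolution product) are those of \<^theory>\<open>HOL-Library.Poly_Mapping\<close>.\<close>

type_synonym 'a multi_poly = "(nat \<Rightarrow>\<^sub>0 nat) \<Rightarrow>\<^sub>0 'a"

definition mp_const :: "'a::zero \<Rightarrow> 'a multi_poly"
  where "mp_const c = Poly_Mapping.single 0 c"

definition mp_var :: "nat \<Rightarrow> 'a::zero_neq_one multi_poly"
  where "mp_var i = Poly_Mapping.single (Poly_Mapping.single i 1) 1"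

text \<open>The type above has infinitely many indeterminates; the polynomial ring in
  \<open>B\<^sub>0, \<dots>, B\<^bsub>n-1\<^esub>\<close> is the subring of those polynomials in whose monomials only indices
  below \<open>n\<close> occur.\<close>

definition mp_ring :: "nat \<Rightarrow> 'a::comm_ring_1 multi_poly ring"
  where "mp_ring n = ring_of_type_algebra
    \<lparr>carrier := {p. \<forall>m \<in> Poly_Mapping.keys p. Poly_Mapping.keys m \<subseteq> {..<n}}\<rparr>"

lemma domain_mp_ring: "domain (mp_ring n :: 'a::idom multi_poly ring)"
proof -
  have plus: "Poly_Mapping.keys (p + q) \<subseteq> Poly_Mapping.keys p \<union> Poly_Mapping.keys q"
    for p q :: "'a multi_poly" by (rule Poly_Mapping.keys_add)
  have times: "\<forall>m \<in> Poly_Mapping.keys (p * q). Poly_Mapping.keys m \<subseteq> {..<n}"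
    if "\<forall>m \<in> Poly_Mapping.keys p. Poly_Mapping.keys m \<subseteq> {..<n}"
       "\<forall>m \<in> Poly_Mapping.keys q. Poly_Mapping.keys m \<subseteq> {..<n}" for p q :: "'a multi_poly"
  proof
    fix m assume "m \<in> Poly_Mapping.keys (p * q)"
    then obtain u v where uv: "u \<in> Poly_Mapping.keys p" "v \<in> Poly_Mapping.keys q" "m = u + v"
      using Poly_Mapping.keys_mult[of p q] by fast
    have "Poly_Mapping.keys m \<subseteq> Poly_Mapping.keys u \<union> Poly_Mapping.keys v"
      unfolding uv(3) by (rule Poly_Mapping.keys_add)
    then show "Poly_Mapping.keys m \<subseteq> {..<n}"
      using that uv(1,2) by blast
  qed
  have uminus: "Poly_Mapping.keys (- p) = Poly_Mapping.keys p" for p :: "'a multi_poly"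
    by transfer simp
  note simps = mp_ring_def ring_of_type_algebra_def
  have add_closed: "p + q \<in> carrier (mp_ring n)"
    if "p \<in> carrier (mp_ring n)" "q \<in> carrier (mp_ring n)" for p q :: "'a multi_poly"
    using that plus[of p q] unfolding simps by fastforce
  have mult_closed: "p * q \<in> carrier (mp_ring n)"
    if "p \<in> carrier (mp_ring n)" "q \<in> carrier (mp_ring n)" for p q :: "'a multi_poly"
    using that times[of p q] unfolding simps by simp
  have minus_closed: "- p \<in> carrier (mp_ring n)"
    if "p \<in> carrier (mp_ring n)" for p :: "'a multi_poly"
    using that unfolding simps by (simp add: uminus)
  have ops: "add (mp_ring n) = (+)" "monoid.mult (mp_ring n) = (*)" "zero (mp_ring n) = 0"
    "one (mp_ring n) = (1 :: 'a multi_poly)" and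
    zero_one: "0 \<in> carrier (mp_ring n)" "(1 :: 'a multi_poly) \<in> carrier (mp_ring n)"
    by (simp_all add: simps)
  have "abelian_group (mp_ring n :: 'a multi_poly ring)"
  proof (rule abelian_groupI, unfold ops)
    fix p :: "'a multi_poly"
    assume "p \<in> carrier (mp_ring n)"
    then show "\<exists>q\<in>carrier (mp_ring n). q + p = 0"
      by (intro bexI[of _ "- p"] minus_closed) simp_all
  qed (simp_all add: add_closed zero_one add_ac)
  moreover have "comm_monoid (mp_ring n :: 'a multi_poly ring)"
    by (rule comm_monoidI, unfold ops) (simp_all add: mult_closed zero_one mult_ac)
  ultimately have "cring (mp_ring n :: 'a multi_poly ring)"
    by (rule cringI) (simp add: ops distrib_right)
  then show ?thesis
    by (rule domainI) (simp_all add: ops)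
qed

text \<open>For monic \<open>f\<close> of degree \<open>n\<close> this is \<open>(-1)\<^bsup>n(n-1)/2\<^esup> Res(f, f')\<close>; no division by
  the leading coefficient is needed. The Sylvester determinant is taken with \<open>f'\<close> regarded as
  a polynomial of formal degree \<open>n - 1\<close>, since its degree may be smaller when the
  characteristic divides \<open>n\<close>. By \<open>resultant_sub_monic\<close> below, the resultant formed with the
  actual degree of \<open>f'\<close> has the same value.\<close>

definition monic_discriminant :: "'a::idom poly \<Rightarrow> 'a"
  where "monic_discriminant f =
    (let n = Polynomial.degree f
     in (-1) ^ (n * (n - 1) div 2) * resultant_sub n (n - 1) f (pderiv f))"

text \<open>Only the entries of \<open>a\<close> at \<open>d-s, \<dots>, d-1\<close> are used, so \<open>a\<close> stands for the vector
  \<open>(a\<^bsub>d-1\<^esub>, \<dots>, a\<^bsub>d-s\<^esub>)\<close>. The outer polynomial variable is \<open>T\<close>.\<close>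

definition family_poly ::
    "nat \<Rightarrow> nat \<Rightarrow> (nat \<Rightarrow> 'a) \<Rightarrow> 'a::idom multi_poly poly"
  where "family_poly d s a =
    Polynomial.monom 1 d
    + (\<Sum>i\<in>{d-s..<d}. Polynomial.monom (mp_const (a i)) i)
    + (\<Sum>i<d-s. Polynomial.monom (mp_var i) i)"

lemma family_poly_monic:
  shows "Polynomial.degree (family_poly d s a) = d"
    and "Polynomial.lead_coeff (family_poly d s a) = 1"
proof -
  have 1: "Polynomial.coeff (family_poly d s a) d = 1"
    by (auto simp: family_poly_def coeff_sum)
  have "Polynomial.degree (family_poly d s a) \<le> d"
    by (rule degree_le) (auto simp: family_poly_def coeff_sum intro!: sum.neutral)
  moreover have "d \<le> Polynomial.degree (family_poly d s a)"
    by (rule le_degree) (simp add: 1)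
  ultimately show "Polynomial.degree (family_poly d s a) = d" by simp
  then show "Polynomial.lead_coeff (family_poly d s a) = 1" using 1 by simp
qed

lemma resultant_sub_monic:
  fixes f g :: "'a::comm_ring_1 poly"
  assumes "Polynomial.lead_coeff f = 1" and "Polynomial.degree g \<le> n"
  shows "resultant_sub (Polynomial.degree f) n f g = resultant f g"
proof -
  define m where "m = Polynomial.degree f"
  have drop_row: "resultant_sub m (Suc k) f g = resultant_sub m k f g"
    if k: "Polynomial.degree g \<le> k" for k
  proof -
    let ?A = "sylvester_mat_sub m (Suc k) f g"
    have A: "?A \<in> carrier_mat (Suc (m + k)) (Suc (m + k))"
      by (simp add: sylvester_mat_sub_def)
    have g0: "Polynomial.coeff g r = 0" if "k < r" for r
      using k that by (simp add: coeff_eq_0)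
    have A0: "?A $$ (i, 0) = (if i = 0 then 1 else 0)" if "i < Suc (m + k)" for i
    proof -
      have "i < m + Suc k" "0 < m + Suc k" using that by simp_all
      then show ?thesis
        using assms(1) g0 by (cases "i < Suc k"; cases "i = Suc k") (auto simp: sylvester_mat_sub_def m_def)
    qed
    have D: "mat_delete ?A 0 0 = sylvester_mat_sub m k f g"
    proof (rule eq_matI)
      fix i j
      assume "i < dim_row (sylvester_mat_sub m k f g)" "j < dim_col (sylvester_mat_sub m k f g)"
      then have ij: "i < m + k" "j < m + k" by simp_all
      have "mat_delete ?A 0 0 $$ (i, j) = ?A $$ (Suc i, Suc j)"
        using ij by (simp add: mat_delete_def)
      also have "\<dots> = sylvester_mat_sub m k f g $$ (i, j)"
        using ij g0 by (cases "i < k"; cases "i \<le> j"; cases "j = Suc i")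
         (auto simp: sylvester_mat_sub_def Suc_diff_le not_le not_less intro!: g0)
      finally show "mat_delete ?A 0 0 $$ (i, j) = sylvester_mat_sub m k f g $$ (i, j)" .
    qed (simp_all add: mat_delete_def)
    have "det ?A = (\<Sum>i<Suc (m + k). ?A $$ (i, 0) * cofactor ?A i 0)"
      by (rule laplace_expansion_column[OF A]) simp
    also have "\<dots> = (\<Sum>i\<in>{0}. cofactor ?A i 0)"
      by (rule sum.mono_neutral_cong_right) (auto simp: A0)
    also have "\<dots> = det (sylvester_mat_sub m k f g)"
      by (simp add: cofactor_def D)
    finally show ?thesis by (simp add: resultant_sub_def)
  qed
  have "resultant_sub m n f g = resultant_sub m (Polynomial.degree g) f g"
    using assms(2)
  proof (induction n rule: dec_induct)
    case (step k)
    then show ?case using drop_row[of k] by simp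
  qed simp
  then show ?thesis
    by (simp add: resultant_sub m_def)
qed
end

(* Give B_i the weight d - i. The part of the discriminant of largest weight, d(d-1), is the
   discriminant of T^d + B_{n-1} T^{n-1} + ... + B_0 (n = d - s), since the a_i have weight 0; so it
   suffices to show that of two factors of this part one has weight 0. Put B_i = 0 for i >= 3
   and let p be the characteristic.
   If p does not divide d(d-1), then B_0^{d-1} and B_1^d both occur, so the weight of a factor is
   divisible by d and by d - 1, hence it is 0 or d(d-1).
   If p | d, the derivative 2 B_2 T + B_1 is linear and the discriminant is linear in B_0, with
   leading coefficient (2 B_2)^d, and is not divisible by B_2.
   If p | d - 1, then f - T f' = B_0 - B_2 T^2, and the discriminant is quadratic in B_1, its own
   discriminant has odd degree in B_2, and it is not divisible by B_2, which is the only
   prime divisor of its leading coefficient.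
   In the last two cases the restricted part is irreducible, so one of the factors restricts to a
   nonzero constant and thus has weight 0. *)
theory Submission
  imports Defs "Subresultants.Subresultant"
begin

section \<open>Isobaric weight of the Sylvester determinant\<close>

section \<open>The leading term of a graded discriminant\<close>

text \<open>The \<open>e i\<close> are upper bounds for the degrees, not the degrees themselves, so
  the coefficient at their sum may vanish; at that exponent every term of the convolution except the
  one taken at the bounds dies.\<close>

lemma coeff_prod_degree_bounds:
  fixes f :: "'b \<Rightarrow> 'a::comm_semiring_1 Polynomial.poly"
  assumes "finite S" and "\<And>i. i \<in> S \<Longrightarrow> Polynomial.degree (f i) \<le> e i"
  shows "Polynomial.degree (prod f S) \<le> sum e S
    \<and> Polynomial.coeff (prod f S) (sum e S) = (\<Prod>i\<in>S. Polynomial.coeff (f i) (e i))"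
  using assms
proof (induction S rule: finite_induct)
  case (insert x S)
  then have d: "Polynomial.degree (f x) \<le> e x" "Polynomial.degree (prod f S) \<le> sum e S"
    and c: "Polynomial.coeff (prod f S) (sum e S) = (\<Prod>i\<in>S. Polynomial.coeff (f i) (e i))"
    by auto
  have "Polynomial.coeff (f x * prod f S) (e x + sum e S)
    = Polynomial.coeff (f x) (e x) * Polynomial.coeff (prod f S) (sum e S)"
  proof -
    have "Polynomial.coeff (f x * prod f S) (e x + sum e S) =
      (\<Sum>i\<le>e x + sum e S. Polynomial.coeff (f x) i * Polynomial.coeff (prod f S) (e x + sum e S - i))"
      by (rule coeff_mult)
    also have "\<dots> = (\<Sum>i\<in>{e x}. Polynomial.coeff (f x) i * Polynomial.coeff (prod f S) (e x + sum e S - i))"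
    proof (rule sum.mono_neutral_right; (intro ballI)?)
      fix i assume "i \<in> {..e x + sum e S} - {e x}"
      then consider "i < e x" | "e x < i" by fastforce
      then show "Polynomial.coeff (f x) i * Polynomial.coeff (prod f S) (e x + sum e S - i) = 0"
      proof cases
        case 1
        then have "Polynomial.degree (prod f S) < e x + sum e S - i" using d(2) by simp
        then show ?thesis by (simp add: coeff_eq_0)
      next
        case 2
        then show ?thesis using d(1) by (simp add: coeff_eq_0)
      qed
    qed auto
    finally show ?thesis by simp
  qed
  moreover have "Polynomial.degree (f x * prod f S) \<le> e x + sum e S"
    using degree_mult_le[of "f x" "prod f S"] d by linarith
  ultimately show ?case using insert.hyps c by simp
qed auto

(* In the Leibniz formula the degrees j - r i of the entries sum up to the same w for every
   permutation. *)
lemma det_top_coeff: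
  fixes A :: "'a::comm_ring_1 Polynomial.poly mat" and r :: "nat \<Rightarrow> nat"
  assumes A: "A \<in> carrier_mat n n" and B: "B \<in> carrier_mat n n"
    and zero: "\<And>i j. i < n \<Longrightarrow> j < n \<Longrightarrow> j < r i \<Longrightarrow> A $$ (i,j) = 0"
    and zero': "\<And>i j. i < n \<Longrightarrow> j < n \<Longrightarrow> j < r i \<Longrightarrow> B $$ (i,j) = 0"
    and deg: "\<And>i j. i < n \<Longrightarrow> j < n \<Longrightarrow> r i \<le> j \<Longrightarrow> Polynomial.degree (A $$ (i,j)) \<le> j - r i"
    and top: "\<And>i j. i < n \<Longrightarrow> j < n \<Longrightarrow> r i \<le> j \<Longrightarrow> Polynomial.coeff (A $$ (i,j)) (j - r i) = B $$ (i,j)"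
    and w: "w + sum r {0..<n} = \<Sum>{0..<n}"
  shows "Polynomial.degree (det A) \<le> w" and "Polynomial.coeff (det A) w = det B"
proof -
  let ?P = "{p. p permutes {0..<n}}"
  have main: "Polynomial.degree (signof p * (\<Prod>i = 0..<n. A $$ (i, p i))) \<le> w
     \<and> Polynomial.coeff (signof p * (\<Prod>i = 0..<n. A $$ (i, p i))) w = signof p * (\<Prod>i = 0..<n. B $$ (i, p i))"
    if p: "p permutes {0..<n}" for p
  proof -
    have pn: "p i < n" if "i < n" for i
      using p that permutes_in_image[OF p, of i] by simp
    have "Polynomial.degree (\<Prod>i = 0..<n. A $$ (i, p i)) \<le> w
     \<and> Polynomial.coeff (\<Prod>i = 0..<n. A $$ (i, p i)) w = (\<Prod>i = 0..<n. B $$ (i, p i))"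
    \<comment> \<open>A permutation that meets a forced zero contributes nothing to either
      determinant. Otherwise no difference \<open>p i - r i\<close> is truncated, and the
      differences can be summed.\<close>
    proof (cases "\<exists>i<n. p i < r i")
      case True
      then obtain i where i: "i < n" "p i < r i" by blast
      then have "(\<Prod>i = 0..<n. A $$ (i, p i)) = 0" "(\<Prod>i = 0..<n. B $$ (i, p i)) = 0"
        using zero[of i "p i"] zero'[of i "p i"] pn by (auto intro!: prod_zero)
      then show ?thesis by simp
    next
      case False
      then have le: "r i \<le> p i" if "i \<in> {0..<n}" for i using that by force
      have "(\<Sum>i=0..<n. p i - r i) + sum r {0..<n} = (\<Sum>i=0..<n. p i - r i + r i)"
        by (simp add: sum.distrib)
      also have "\<dots> = (\<Sum>i=0..<n. p i)" using le by (intro sum.cong) auto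
      also have "\<dots> = \<Sum>{0..<n}" using sum.permute[OF p, of id] by (simp add: comp_def)
      finally have s: "(\<Sum>i=0..<n. p i - r i) = w" using w by simp
      show ?thesis
        using coeff_prod_degree_bounds[of "{0..<n}" "\<lambda>i. A $$ (i, p i)" "\<lambda>i. p i - r i"]
          deg pn le top unfolding s by (auto intro!: prod.cong)
    qed
    then show ?thesis by (cases "evenperm p") (simp_all add: sign_def)
  qed
  show "Polynomial.degree (det A) \<le> w"
    unfolding det_def'[OF A] using main by (intro degree_sum_le) (auto simp: finite_permutations)
  show "Polynomial.coeff (det A) w = det B"
    unfolding det_def'[OF A] det_def'[OF B] coeff_sum using main by (intro sum.cong) auto
qed

text \<open>Here \<open>hom\<close> need not be injective. Monicity preserves the degree of
  \<open>f\<close>, and the formal degree of the derivative depends only on that, so the Sylvester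
  matrix keeps its size even when the leading coefficient of the derivative is killed.\<close>

lemma (in idom_hom) monic_discriminant_map_poly:
  assumes "Polynomial.lead_coeff f = 1"
  shows "monic_discriminant (map_poly hom f) = hom (monic_discriminant f)"
proof -
  have d: "Polynomial.degree (map_poly hom f) = Polynomial.degree f"
    using assms by (intro degree_map_poly) auto
  show ?thesis
    unfolding monic_discriminant_def Let_def d resultant_sub_def map_poly_pderiv[symmetric]
      sylvester_mat_sub_map[of hom, OF hom_zero, symmetric] hom_det hom_mult hom_power hom_uminus hom_one ..
qed

text \<open>The discriminant is isobaric of weight d(d-1) when the coefficient of T^i has weight d -
  i; hence taking top coefficients commutes with it. The bounds on the entries of \<open>F\<close>
  need not be attained.\<close>

lemma monic_discriminant_top_coeff:
  fixes F :: "'a::idom Polynomial.poly Polynomial.poly" and g :: "'a Polynomial.poly"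
  assumes d: "Polynomial.degree F = d" "Polynomial.degree g = d"
    and deg: "\<And>i. i \<le> d \<Longrightarrow> Polynomial.degree (Polynomial.coeff F i) \<le> d - i"
    and top: "\<And>i. i \<le> d \<Longrightarrow> Polynomial.coeff (Polynomial.coeff F i) (d - i) = Polynomial.coeff g i"
  shows "Polynomial.degree (monic_discriminant F) \<le> d * (d - 1)"
    and "Polynomial.coeff (monic_discriminant F) (d * (d - 1)) = monic_discriminant g"
proof -
  let ?n = "d + (d - 1)"
  let ?A = "sylvester_mat_sub d (d - 1) F (pderiv F)"
  let ?B = "sylvester_mat_sub d (d - 1) g (pderiv g)"
  \<comment> \<open>Row \<open>i\<close> of the Sylvester matrix starts at column
    \<open>r i\<close>: first d - 1 shifted copies of \<open>F\<close>, then d shifted copies of its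
    derivative. Moving right lowers the index of the coefficient, so entry (i, j) has weight j - r
    i.\<close>
  define r where "r i = (if i < d - 1 then i else i - (d - 1))" for i
  have deg': "Polynomial.degree (Polynomial.coeff (pderiv F) i) \<le> d - 1 - i" if "i \<le> d - 1" for i
  proof (cases "Suc i \<le> d")
    case True
    have "Polynomial.degree (of_nat (Suc i) * Polynomial.coeff F (Suc i)) \<le> Polynomial.degree (Polynomial.coeff F (Suc i))"
      by (simp add: of_nat_poly degree_smult_le del: of_nat_Suc)
    then show ?thesis unfolding coeff_pderiv using deg[OF True] by simp
  next
    case False
    then show ?thesis using d by (simp add: coeff_pderiv coeff_eq_0)
  qed
  have top': "Polynomial.coeff (Polynomial.coeff (pderiv F) i) (d - 1 - i) = Polynomial.coeff (pderiv g) i" for i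
  proof (cases "Suc i \<le> d")
    case True
    then show ?thesis using top[OF True] by (simp add: coeff_pderiv of_nat_poly del: of_nat_Suc)
  next
    case False
    then show ?thesis using d by (simp add: coeff_pderiv coeff_eq_0)
  qed
  have gauss: "2 * (\<Sum>i = 0..<k. i) + k = k * k" for k :: nat
    by (induction k) (auto simp: algebra_simps)
  \<comment> \<open>Column indices minus row shifts: (2d-1)(d-1) - (d-1)(d-2)/2 - d(d-1)/2 =
    d(d-1).\<close>
  have w: "d * (d - 1) + sum r {0..<?n} = \<Sum>{0..<?n}"
  proof (cases d)
    case (Suc e)
    have "sum r {0..<?n} = (\<Sum>i = 0..<e. r i) + (\<Sum>i = 0 + e..<Suc e + e. r i)"
      using Suc by (simp add: sum.atLeastLessThan_concat)
    also have "(\<Sum>i = 0 + e..<Suc e + e. r i) = (\<Sum>i = 0..<Suc e. i)"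
      unfolding sum.shift_bounds_nat_ivl by (simp add: r_def Suc)
    also have "(\<Sum>i = 0..<e. r i) = (\<Sum>i = 0..<e. i)"
      by (simp add: r_def Suc)
    finally have "2 * (d * (d - 1) + sum r {0..<?n}) = 2 * \<Sum>{0..<?n}"
      using gauss[of e] gauss[of ?n] Suc by (simp add: distrib_left distrib_right)
    then show ?thesis by simp
  qed simp
  have A: "?A \<in> carrier_mat ?n ?n" "?B \<in> carrier_mat ?n ?n" by auto
  note ix = sylvester_mat_sub_index
  have zA: "?A $$ (i,j) = 0" "?B $$ (i,j) = 0" if "i < ?n" "j < ?n" "j < r i" for i j
    using that by (auto simp: ix r_def)
  have dA: "Polynomial.degree (?A $$ (i,j)) \<le> j - r i" "Polynomial.coeff (?A $$ (i,j)) (j - r i) = ?B $$ (i,j)"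
    if ij: "i < ?n" "j < ?n" "r i \<le> j" for i j
  proof -
    have "Polynomial.degree (?A $$ (i,j)) \<le> j - r i \<and> Polynomial.coeff (?A $$ (i,j)) (j - r i) = ?B $$ (i,j)"
    proof (cases "i < d - 1")
      case True
      then show ?thesis using ij deg[of "d + i - j"] top[of "d + i - j"] by (auto simp: ix r_def)
    next
      case False
      then show ?thesis using ij deg'[of "i - j"] top'[of "i - j"] by (auto simp: ix r_def add.commute[of j d])
    qed
    then show "Polynomial.degree (?A $$ (i,j)) \<le> j - r i" "Polynomial.coeff (?A $$ (i,j)) (j - r i) = ?B $$ (i,j)"
      by auto
  qed
  note det = det_top_coeff[OF A zA dA w]
  have s: "(- 1) ^ k * p = smult ((- 1) ^ k) p" for k and p :: "'a Polynomial.poly"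
    by (cases "even k") auto
  show "Polynomial.degree (monic_discriminant F) \<le> d * (d - 1)"
    using det(1) degree_smult_le le_trans unfolding monic_discriminant_def Let_def resultant_sub_def d s by blast
  show "Polynomial.coeff (monic_discriminant F) (d * (d - 1)) = monic_discriminant g"
    using det(2) unfolding monic_discriminant_def Let_def resultant_sub_def d s by simp
qed

section \<open>Substitution homomorphisms on multivariate polynomials, and the weight of a
  monomial\<close>

section \<open>Evaluation of multivariate polynomials\<close>

definition monomial_value :: "(nat \<Rightarrow> 'r::comm_monoid_mult) \<Rightarrow> (nat \<Rightarrow>\<^sub>0 nat) \<Rightarrow> 'r"
  where "monomial_value x m = (\<Prod>i\<in>Poly_Mapping.keys m. x i ^ Poly_Mapping.lookup m i)"

text \<open>The homomorphism of the universal property: \<open>h\<close> acts on the coefficients,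
  \<open>x\<close> gives the images of the indeterminates. The grading, the projection to finitely
  many indeterminates and all specializations are instances.\<close>

definition mp_eval :: "('k::zero \<Rightarrow> 'r::comm_semiring_1) \<Rightarrow> (nat \<Rightarrow> 'r) \<Rightarrow> 'k multi_poly \<Rightarrow> 'r"
  where "mp_eval h x p = (\<Sum>m\<in>Poly_Mapping.keys p. h (Poly_Mapping.lookup p m) * monomial_value x m)"

lemma monomial_value_superset:
  assumes "finite S" "Poly_Mapping.keys m \<subseteq> S"
  shows "monomial_value x m = (\<Prod>i\<in>S. x i ^ Poly_Mapping.lookup m i)"
  unfolding monomial_value_def using assms
  by (intro prod.mono_neutral_left) (auto simp: in_keys_iff)

lemma monomial_value_zero [simp]: "monomial_value x 0 = 1"
  by (simp add: monomial_value_def)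

lemma monomial_value_single [simp]: "monomial_value x (Poly_Mapping.single i k) = x i ^ k"
  by (simp add: monomial_value_def)

lemma monomial_value_add:
  "monomial_value x (m + m') = monomial_value x m * monomial_value x m'"
proof -
  let ?S = "Poly_Mapping.keys m \<union> Poly_Mapping.keys m'"
  have "Poly_Mapping.keys (m + m') \<subseteq> ?S" by (rule Poly_Mapping.keys_add)
  moreover have "monomial_value x m = (\<Prod>i\<in>?S. x i ^ Poly_Mapping.lookup m i)"
    "monomial_value x m' = (\<Prod>i\<in>?S. x i ^ Poly_Mapping.lookup m' i)"
    by (intro monomial_value_superset; simp)+
  ultimately show ?thesis
    by (simp add: monomial_value_superset[of ?S "m + m'"] lookup_add power_add prod.distrib)
qed

lemma multi_poly_eq_sum_single:
  "p = (\<Sum>m\<in>Poly_Mapping.keys p. Poly_Mapping.single m (Poly_Mapping.lookup p m))"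
  by (intro poly_mapping_eqI)
    (simp add: lookup_sum lookup_single when_def in_keys_iff sum.delta' flip: sum.delta')

context comm_ring_hom
begin

lemma mp_eval_superset:
  assumes "finite S" "Poly_Mapping.keys p \<subseteq> S"
  shows "mp_eval hom x p = (\<Sum>m\<in>S. hom (Poly_Mapping.lookup p m) * monomial_value x m)"
  unfolding mp_eval_def using assms
  by (intro sum.mono_neutral_left) (auto simp: in_keys_iff)

lemma mp_eval_single: "mp_eval hom x (Poly_Mapping.single m c) = hom c * monomial_value x m"
  by (subst mp_eval_superset[of "{m}"]) auto

lemma mp_eval_add: "mp_eval hom x (p + q) = mp_eval hom x p + mp_eval hom x q"
proof -
  let ?S = "Poly_Mapping.keys p \<union> Poly_Mapping.keys q"
  have "Poly_Mapping.keys (p + q) \<subseteq> ?S" by (rule Poly_Mapping.keys_add)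
  then show ?thesis
    using mp_eval_superset[of ?S]
    by (simp add: lookup_add hom_add distrib_right sum.distrib)
qed

lemma mp_eval_zero: "mp_eval hom x 0 = 0"
  by (simp add: mp_eval_def)

lemma mp_eval_sum: "mp_eval hom x (sum f A) = (\<Sum>i\<in>A. mp_eval hom x (f i))"
  by (induction A rule: infinite_finite_induct) (auto simp: mp_eval_add mp_eval_zero)

lemma mp_eval_mult: "mp_eval hom x (p * q) = mp_eval hom x p * mp_eval hom x q"
proof -
  have "mp_eval hom x (p * q) = mp_eval hom x
      ((\<Sum>m\<in>Poly_Mapping.keys p. Poly_Mapping.single m (Poly_Mapping.lookup p m)) *
       (\<Sum>m\<in>Poly_Mapping.keys q. Poly_Mapping.single m (Poly_Mapping.lookup q m)))"
    using multi_poly_eq_sum_single[of p] multi_poly_eq_sum_single[of q] by simp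
  also have "\<dots> = mp_eval hom x p * mp_eval hom x q"
    unfolding sum_product mp_eval_sum mult_single mp_eval_single
    by (simp add: mp_eval_def[of hom x] sum_product hom_mult monomial_value_add mult_ac)
  finally show ?thesis .
qed

lemma mp_eval_const: "mp_eval hom x (mp_const c) = hom c"
  by (simp add: mp_const_def mp_eval_single)

lemma mp_eval_var: "mp_eval hom x (mp_var i) = x i"
  by (simp add: mp_var_def mp_eval_single)

lemma comm_ring_hom_mp_eval: "comm_ring_hom (mp_eval hom x)"
  using mp_eval_single[of x 0 1]
  by unfold_locales (auto simp: mp_eval_zero mp_eval_add mp_eval_mult)

end

lemma comm_ring_hom_mp_const: "comm_ring_hom (mp_const :: 'a::comm_ring_1 \<Rightarrow> _)"
  by unfold_locales (auto simp: mp_const_def single_add mult_single)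

lemma monomial_value_mp_var: "monomial_value mp_var m = (Poly_Mapping.single m 1 :: 'a::comm_ring_1 multi_poly)"
proof (induction m rule: update_induct)
  case const
  then show ?case by simp
next
  case (update f a b)
  have f0: "Poly_Mapping.lookup f a = 0" using update by (simp add: in_keys_iff)
  have eq: "Poly_Mapping.update a b f = f + Poly_Mapping.single a b"
    using f0 by (intro poly_mapping_eqI) (auto simp: lookup_update lookup_add lookup_single when_def)
  have pow: "(mp_var a :: 'a multi_poly) ^ b = Poly_Mapping.single (Poly_Mapping.single a b) 1"
    by (induction b) (simp_all add: mp_var_def mult_single flip: single_add)
  show ?case unfolding eq monomial_value_add update.IH using pow by (simp add: mult_single)
qed

text \<open>The root weights: T has weight 1 and \<open>B_i\<close> weight d - i, which makes the
  polynomial without the \<open>a_i\<close> homogeneous. The subtraction is truncated, so only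
  indices below \<open>d\<close> have positive weight.\<close>

definition weight :: "nat \<Rightarrow> (nat \<Rightarrow>\<^sub>0 nat) \<Rightarrow> nat"
  where "weight d m = (\<Sum>i\<in>Poly_Mapping.keys m. (d - i) * Poly_Mapping.lookup m i)"

lemma monomial_value_weighted:
  "monomial_value (\<lambda>i. Polynomial.monom (b i) (d - i)) m = Polynomial.monom (monomial_value b m) (weight d m)"
proof -
  have "(\<Prod>i\<in>A. Polynomial.monom (b i) (d - i) ^ f i) =
    Polynomial.monom (\<Prod>i\<in>A. b i ^ f i) (\<Sum>i\<in>A. (d - i) * f i)" for A and f :: "nat \<Rightarrow> nat"
    by (induction A rule: infinite_finite_induct) (simp_all add: monom_power mult_monom mult_ac monom_0)
  then show ?thesis by (simp add: monomial_value_def weight_def)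
qed

section \<open>Explicit discriminants, up to sign, by Euclidean steps\<close>

section \<open>Discriminants of trinomials and quadrinomials\<close>

text \<open>Modulo \<open>G\<close> the polynomials \<open>F\<close> and \<open>H\<close> agree, so
  the two resultants differ only by a sign and by the power of the leading coefficient of
  \<open>G\<close> that accounts for the drop in degree. The sign is left open, as it does not
  affect factorizations.\<close>

lemma resultant_euclid_step:
  fixes F G H B :: "'a::idom Polynomial.poly"
  assumes eq: "F + B * G = H" and le: "Polynomial.degree G \<le> Polynomial.degree F"
    and less: "Polynomial.degree H < Polynomial.degree G"
  obtains u where "u \<in> {1, - 1}"
    "resultant F G = u * Polynomial.lead_coeff G ^ (Polynomial.degree F - Polynomial.degree H) * resultant G H"
proof (cases "Polynomial.degree H = 0")
  \<comment> \<open>The reduction formula for subresultants of index 0 requires \<open>H\<close> to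
    have positive degree. For a constant \<open>H\<close>, possibly 0, the formula for the
    subresultant of index \<open>degree H\<close> is used instead.\<close>
  case True
  then obtain h where H: "H = [:h:]" using degree_0_id by metis
  let ?u = "(- 1) ^ (Polynomial.degree F * Polynomial.degree G) :: 'a"
  have "[:resultant F G:] = Polynomial.smult (?u * Polynomial.lead_coeff G ^ Polynomial.degree F * h ^ (Polynomial.degree G - 1)) H"
    using BT_lemma_1_13[OF eq le disjI1[OF less] disjI1[OF less]] subresultant_resultant[of F G] H by simp
  then have "resultant F G = ?u * Polynomial.lead_coeff G ^ Polynomial.degree F * (h ^ (Polynomial.degree G - 1) * h)"
    by (simp add: H)
  also have "h ^ (Polynomial.degree G - 1) * h = h ^ Polynomial.degree G"
    using less by (metis power_minus_mult gr_implies_not0 gr0I)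
  finally show ?thesis
    using that[of ?u] by (cases "even (Polynomial.degree F * Polynomial.degree G)") (auto simp: H)
next
  case False
  let ?u = "(- 1) ^ (Polynomial.degree F * Polynomial.degree G) :: 'a"
  have "[:resultant F G:] = Polynomial.smult (?u * Polynomial.lead_coeff G ^ (Polynomial.degree F - Polynomial.degree H)) [:resultant G H:]"
    using BT_lemma_1_12[OF eq le disjI1[OF less], of 0] False subresultant_resultant by (metis diff_zero gr0I)
  then show ?thesis
    using that[of ?u] by (cases "even (Polynomial.degree F * Polynomial.degree G)") auto
qed

lemma power_diff_dvd: "x - y dvd x ^ n - y ^ n" for x y :: "'a::comm_ring_1"
proof (induction n)
  case (Suc n)
  have "x ^ Suc n - y ^ Suc n = (x - y) * x ^ n + y * (x ^ n - y ^ n)" by (simp add: algebra_simps)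
  then show ?case using Suc by simp
qed simp

lemma resultant_quadratic_linear:
  fixes \<alpha> :: "'a::idom"
  assumes "\<alpha> \<noteq> 0" "\<gamma> \<noteq> 0"
  shows "\<exists>u\<in>{1, - 1}. resultant [:\<beta>, 0, \<alpha>:] [:\<delta>, \<gamma>:] = u * (\<beta> * \<gamma>\<^sup>2 + \<alpha> * \<delta>\<^sup>2)"
proof -
  let ?F = "[:\<beta>, 0, \<alpha>:]" and ?G = "[:\<delta>, \<gamma>:]"
  \<comment> \<open>Pseudo-division: the remainder is \<gamma>^2 times the value of the quadratic at
    the root -\<delta>/\<gamma>, and this factor cancels in the end.\<close>
  have "Polynomial.smult (\<gamma>\<^sup>2) ?F + [:\<alpha> * \<delta>, - \<alpha> * \<gamma>:] * ?G = [:\<beta> * \<gamma>\<^sup>2 + \<alpha> * \<delta>\<^sup>2:]"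
    by (simp add: power2_eq_square algebra_simps)
  then obtain u where "u \<in> {1, - 1}" "resultant (Polynomial.smult (\<gamma>\<^sup>2) ?F) ?G = u * \<gamma>\<^sup>2 * (\<beta> * \<gamma>\<^sup>2 + \<alpha> * \<delta>\<^sup>2)"
    by (rule resultant_euclid_step) (use assms in \<open>auto simp: power2_eq_square\<close>)
  then show ?thesis using assms resultant_smult_left[of "\<gamma>\<^sup>2" ?F ?G] by (intro bexI[of _ u]) auto
qed

lemma monom_add_lower_monic:
  fixes q :: "'a::idom Polynomial.poly"
  assumes "Polynomial.degree q < d"
  shows "Polynomial.degree (Polynomial.monom 1 d + q) = d" "Polynomial.lead_coeff (Polynomial.monom 1 d + q) = 1"
    "Polynomial.monom 1 d + q \<noteq> 0"
proof -
  show 1: "Polynomial.degree (Polynomial.monom 1 d + q) = d"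
    using assms by (subst degree_add_eq_left) (simp_all add: Polynomial.degree_monom_eq)
  show 2: "Polynomial.lead_coeff (Polynomial.monom 1 d + q) = 1"
    unfolding 1 using assms by (simp add: coeff_eq_0)
  show "Polynomial.monom 1 d + q \<noteq> 0" using 2 by force
qed

lemma monic_discriminant_resultant:
  fixes F :: "'a::idom Polynomial.poly"
  assumes "Polynomial.lead_coeff F = 1"
  shows "\<exists>u\<in>{1, - 1}. monic_discriminant F = u * resultant F (pderiv F)"
proof -
  have "Polynomial.degree (pderiv F) \<le> Polynomial.degree F - 1" 
    by (rule degree_pderiv_le)
  from resultant_sub_monic[OF assms this] show ?thesis
    unfolding monic_discriminant_def Let_def
    by (cases "even (Polynomial.degree F * (Polynomial.degree F - 1) div 2)") auto
qed

lemma degree_pCons_less: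
  shows "1 < d \<Longrightarrow> Polynomial.degree [:b0, b1:] < d" "2 < d \<Longrightarrow> Polynomial.degree [:b0, b1, b2:] < d"
  by (simp_all add: degree_pCons_eq_if)

lemma pderiv_trinomial:
  "pderiv (Polynomial.monom 1 d + [:b0, b1, b2:]) = Polynomial.monom (of_nat d) (d - 1) + [:b1, 2 * b2:]"
  by (simp add: pderiv_add pderiv_monom pderiv_pCons mult_2)

lemma sign_mult_sign: "u \<in> {1, - 1} \<Longrightarrow> v \<in> {1, - 1} \<Longrightarrow> u * v \<in> {1, - 1 :: 'a::comm_ring_1}"
  by auto

text \<open>Witnesses a pure power of \<open>B_0\<close> in the top part. Subtracting T/d times the
  derivative from T^d + 1 leaves 1.\<close>

lemma monic_discriminant_binomial_0:
  assumes "of_nat d \<noteq> (0::'a::field)" "2 \<le> d"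
  shows "monic_discriminant (Polynomial.monom 1 d + [:1, 0, 0:]) \<noteq> (0::'a)"
proof -
  let ?F = "Polynomial.monom 1 d + [:1, 0, 0:] :: 'a Polynomial.poly"
  let ?G = "Polynomial.monom (of_nat d) (d - 1) :: 'a Polynomial.poly"
  have G: "pderiv ?F = ?G" using pderiv_trinomial[of d "1::'a" 0 0] by simp
  have F: "Polynomial.degree ?F = d" "Polynomial.lead_coeff ?F = 1"
    using monom_add_lower_monic[of "[:1, 0, 0:]" d] assms by auto
  have dG: "Polynomial.degree ?G = d - 1" using assms by (simp add: Polynomial.degree_monom_eq)
  have "?F + (- [:0, inverse (of_nat d):]) * ?G = 1"
    using assms by (cases d) (simp_all add: smult_monom monom_Suc add_monom)
  then obtain u where "u \<in> {1, - 1}" "resultant ?F ?G = u * of_nat d ^ d"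
    by (rule resultant_euclid_step) (use assms dG F in auto)
  moreover obtain v where "v \<in> {1, - 1}" "monic_discriminant ?F = v * resultant ?F ?G"
    using monic_discriminant_resultant[OF F(2)] unfolding G by blast
  ultimately show ?thesis using assms by auto
qed

text \<open>Witnesses a pure power of \<open>B_1\<close> in the top part. Subtracting T/d times the
  derivative from T^d + T leaves (1 - 1/d) T, nonzero since d - 1 is invertible; the derivative then
  leaves the remainder 1 modulo T.\<close>

lemma monic_discriminant_binomial_1:
  assumes "of_nat d \<noteq> (0::'a::field)" "of_nat (d - 1) \<noteq> (0::'a)" "3 \<le> d"
  shows "monic_discriminant (Polynomial.monom 1 d + [:0, 1, 0:]) \<noteq> (0::'a)"
proof -
  let ?d = "of_nat d :: 'a"
  let ?F = "Polynomial.monom 1 d + [:0, 1, 0:] :: 'a Polynomial.poly"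
  let ?G = "Polynomial.monom ?d (d - 1) + 1 :: 'a Polynomial.poly"
  define c where "c = 1 - inverse ?d"
  have ui: "?d * inverse ?d = 1" using assms by simp
  have d1: "?d - 1 \<noteq> 0" using assms by simp
  then have c: "c \<noteq> 0" using assms by (simp add: c_def field_simps)
  have G: "pderiv ?F = ?G" using pderiv_trinomial[of d "0::'a" 1 0] by simp
  have F: "Polynomial.degree ?F = d" "Polynomial.lead_coeff ?F = 1"
    using monom_add_lower_monic[of "[:0, 1, 0:]" d] assms by auto
  have dG: "Polynomial.degree ?G = d - 1" 
    using assms by (subst degree_add_eq_left) (simp_all add: Polynomial.degree_monom_eq)
  have lG: "Polynomial.lead_coeff ?G = ?d" unfolding dG using assms by simp
  have "?F + (- [:0, inverse ?d:]) * ?G = [:0, c:]"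
    using assms ui by (intro poly_eqI, cases d) (auto simp: coeff_pCons c_def algebra_simps simp del: of_nat_Suc split: nat.splits)
  then obtain u where u: "u \<in> {1, - 1}" "resultant ?F ?G = u * ?d ^ (d - 1) * resultant ?G [:0, c:]"
    by (rule resultant_euclid_step) (use assms dG F lG c in auto)
  have "?G + (- Polynomial.monom (?d / c) (d - 2)) * [:0, c:] = 1"
  proof -
    have "Polynomial.monom (?d / c) (d - 2) * [:0, c:] = Polynomial.monom ?d (d - 1)"
    proof -
      have "[:0, c:] = Polynomial.monom c 1" by (simp add: monom_Suc monom_0)
      moreover have "d - 2 + 1 = d - 1" using assms by simp
      ultimately show ?thesis using c by (simp only: mult_monom) simp
    qed
    then show ?thesis unfolding mult_minus_left by (simp only:) simp
  qed
  then obtain w where "w \<in> {1, - 1}" "resultant ?G [:0, c:] = w * c ^ (d - 1)"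
    by (rule resultant_euclid_step) (use assms dG c in auto)
  moreover obtain v where "v \<in> {1, - 1}" "monic_discriminant ?F = v * resultant ?F ?G"
    using monic_discriminant_resultant[OF F(2)] unfolding G by blast
  ultimately show ?thesis using u assms c by auto
qed

text \<open>The derivative is the linear polynomial 2 b2 T + b1, and the bracket is (2 b2)^d times
  the value of the polynomial at its root -b1/(2 b2).\<close>

lemma monic_discriminant_char_dvd_degree:
  fixes b0 b1 b2 :: "'a::idom"
  assumes d0: "of_nat d = (0::'a)" and d: "3 \<le> d" and nz: "2 * b2 \<noteq> 0"
  shows "\<exists>u\<in>{1, - 1}. monic_discriminant (Polynomial.monom 1 d + [:b0, b1, b2:])
    = u * ((2 * b2) ^ d * b0 - (2 * b2) ^ (d - 2) * b2 * b1\<^sup>2 + (- b1) ^ d)"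
proof -
  let ?F = "Polynomial.monom 1 d + [:b0, b1, b2:]" and ?G = "[:b1, 2 * b2:]"
  define c where "c = (2 * b2) ^ d * b0 - (2 * b2) ^ (d - 2) * b2 * b1\<^sup>2 + (- b1) ^ d"
  have F: "Polynomial.degree ?F = d" "Polynomial.lead_coeff ?F = 1"
    using monom_add_lower_monic[OF degree_pCons_less(2), of d b0 b1 b2] d by linarith+
  have G: "pderiv ?F = ?G" by (simp add: pderiv_trinomial d0)
  \<comment> \<open>Up to the factor (2 b2)^d, \<open>?F\<close> is a polynomial in x = 2 b2 T, and
    x is congruent to -b1 modulo \<open>?G\<close>. Replacing x by -b1 therefore gives the remainder
    \<open>c\<close> without any division.\<close>
  define x where "x = [:0, 2 * b2:]"
  have xG: "x - [:- b1:] = ?G" by (simp add: x_def)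
  define e where "e = d - 2"
  have e: "d = Suc (Suc e)" using d by (simp add: e_def)
  have xd: "x ^ n = Polynomial.monom ((2 * b2) ^ n) n" for n
  proof -
    have "x = Polynomial.monom (2 * b2) 1" by (simp add: x_def monom_Suc monom_0)
    then show ?thesis by (simp add: monom_power)
  qed
  have x2: "x ^ 2 = [:0, 0, (2 * b2)\<^sup>2:]" by (simp add: x_def power2_eq_square)
  have "Polynomial.smult ((2 * b2) ^ d) ?F - [:c:] = (x ^ d - [:- b1:] ^ d)
      + Polynomial.smult ((2 * b2) ^ e * b2) (x ^ 2 - [:- b1:] ^ 2)
      + Polynomial.smult ((2 * b2) ^ Suc e * b1) (x - [:- b1:])"
    unfolding xd[of d] x2 poly_const_pow xG
    by (simp add: smult_add_right smult_monom c_def e power2_eq_square algebra_simps)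
  also have "?G dvd \<dots>"
    using power_diff_dvd[of x "[:- b1:]"] unfolding xG by (intro dvd_add dvd_smult) auto
  finally obtain B where "Polynomial.smult ((2 * b2) ^ d) ?F - [:c:] = ?G * B" by (elim dvdE)
  then have "Polynomial.smult ((2 * b2) ^ d) ?F + (- B) * ?G = [:c:]" by (simp add: algebra_simps)
  then obtain u where u: "u \<in> {1, - 1}" "resultant (Polynomial.smult ((2 * b2) ^ d) ?F) ?G = u * (2 * b2) ^ d * c"
    by (rule resultant_euclid_step) (use nz F d in auto)
  then have "resultant ?F ?G = u * c" using nz by (subst (asm) resultant_smult_left) auto
  moreover obtain v where "v \<in> {1, - 1}" "monic_discriminant ?F = v * resultant ?F ?G"
    using monic_discriminant_resultant[OF F(2)] unfolding G by blast
  ultimately show ?thesis unfolding c_def[symmetric] using u(1) sign_mult_sign[of v u] by (intro bexI[of _ "v * u"]) auto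
qed

text \<open>Since d = 1 in the ring, subtracting T times the derivative cancels both T^d and b1 T.
  The derivative is monic, so the Euclidean step introduces no extra factor.\<close>

lemma monic_discriminant_char_dvd_pred_degree:
  fixes b0 b1 b2 :: "'a::idom"
  assumes d1: "of_nat d = (1::'a)" and d: "4 \<le> d" and nz: "b2 \<noteq> 0"
  shows "\<exists>u\<in>{1, - 1}. monic_discriminant (Polynomial.monom 1 d + [:b0, b1, b2:])
    = u * resultant (Polynomial.monom 1 (d - 1) + [:b1, 2 * b2:]) [:b0, 0, - b2:]"
proof -
  let ?F = "Polynomial.monom 1 d + [:b0, b1, b2:]" and ?G = "Polynomial.monom 1 (d - 1) + [:b1, 2 * b2:]"
  have F: "Polynomial.degree ?F = d" "Polynomial.lead_coeff ?F = 1"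
    using monom_add_lower_monic[OF degree_pCons_less(2), of d b0 b1 b2] d by linarith+
  have dG: "Polynomial.degree ?G = d - 1" "Polynomial.lead_coeff ?G = 1" 
    using monom_add_lower_monic[OF degree_pCons_less(1), of "d - 1" b1 "2 * b2"] d by linarith+
  have G: "pderiv ?F = ?G" by (simp add: pderiv_trinomial d1)
  have "?F + (- [:0, 1:]) * ?G = [:b0, 0, - b2:]"
    using d by (cases d) (simp_all add: monom_Suc)
  then obtain u where u: "u \<in> {1, - 1}" "resultant ?F ?G = u * resultant ?G [:b0, 0, - b2:]"
    by (rule resultant_euclid_step) (use nz F dG d in auto)
  moreover obtain v where "v \<in> {1, - 1}" "monic_discriminant ?F = v * resultant ?F ?G"
    using monic_discriminant_resultant[OF F(2)] unfolding G by blast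
  ultimately show ?thesis using sign_mult_sign[of v u] by (intro bexI[of _ "v * u"]) auto
qed

(* The factor b2 on the left absorbs the exponent 2k + e - 1 of the leading coefficient of
   b0 - b2 T^2 that the Euclidean step produces. *)
lemma resultant_reduce_quadratic:
  fixes b0 b2 :: "'a::idom"
  assumes F: "Polynomial.degree F = 2 * k + e" "e \<le> 1" "1 \<le> k" and b2: "b2 \<noteq> 0" and \<gamma>: "\<gamma> \<noteq> 0"
    and eq: "Polynomial.smult (b2 ^ k) F = (Polynomial.monom (b2 ^ k) (2 * k) - [:b0 ^ k:]) * B + [:\<delta>, \<gamma>:]"
  shows "\<exists>u\<in>{1, - 1}. b2 * resultant F [:b0, 0, - b2:] = u * b2 ^ e * (b0 * \<gamma>\<^sup>2 - b2 * \<delta>\<^sup>2)"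
proof -
  let ?H = "[:b0, 0, - b2:]"
  have "[:0, 0, b2:] ^ k = Polynomial.monom (b2 ^ k) (2 * k)"
  proof -
    have "[:0, 0, b2:] = Polynomial.monom b2 2" by (simp add: monom_Suc monom_0 numeral_2_eq_2)
    then show ?thesis by (simp add: monom_power)
  qed
  \<comment> \<open>Modulo b0 - b2 T^2 the power (b2 T^2)^k becomes b0^k, so \<open>eq\<close>
    exhibits the linear polynomial \<gamma> T + \<delta> as the remainder of b2^k
    \<open>F\<close>.\<close>
  then have "[:0, 0, b2:] - [:b0:] dvd Polynomial.monom (b2 ^ k) (2 * k) - [:b0 ^ k:]"
    using power_diff_dvd[of "[:0, 0, b2:]" "[:b0:]" k] by (simp add: poly_const_pow)
  then obtain C where "Polynomial.monom (b2 ^ k) (2 * k) - [:b0 ^ k:] = ([:0, 0, b2:] - [:b0:]) * C" by (elim dvdE)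
  also have "[:0, 0, b2:] - [:b0:] = - ?H" by simp
  finally have C: "Polynomial.monom (b2 ^ k) (2 * k) - [:b0 ^ k:] = - (?H * C)" by simp
  have "Polynomial.smult (b2 ^ k) F + (C * B) * ?H = [:\<delta>, \<gamma>:]"
    unfolding eq C by (simp add: algebra_simps)
  then obtain u where u: "u \<in> {1, - 1}" "resultant (Polynomial.smult (b2 ^ k) F) ?H = u * (- b2) ^ (2 * k + e - 1) * resultant ?H [:\<delta>, \<gamma>:]"
    by (rule resultant_euclid_step) (use F b2 \<gamma> in auto)
  have "- b2 \<noteq> 0" using b2 by simp
  from resultant_quadratic_linear[OF this \<gamma>] obtain v where v: "v \<in> {1, - 1}" "resultant ?H [:\<delta>, \<gamma>:] = v * (b0 * \<gamma>\<^sup>2 + (- b2) * \<delta>\<^sup>2)"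
    by blast
  have "(b2 ^ k)\<^sup>2 * resultant F ?H = u * (- b2) ^ (2 * k + e - 1) * (v * (b0 * \<gamma>\<^sup>2 + (- b2) * \<delta>\<^sup>2))"
    using u(2) b2 unfolding v(2) by (subst (asm) resultant_smult_left) (auto simp: power2_eq_square)
  then have "b2 * ((b2 ^ k)\<^sup>2 * resultant F ?H) = b2 * (u * (- b2) ^ (2 * k + e - 1) * (v * (b0 * \<gamma>\<^sup>2 + (- b2) * \<delta>\<^sup>2)))"
    by simp
  also have "\<dots> = - (u * v) * ((- b2) * (- b2) ^ (2 * k + e - 1)) * (b0 * \<gamma>\<^sup>2 - b2 * \<delta>\<^sup>2)"
    by (simp add: algebra_simps)
  also have "(- b2) * (- b2) ^ (2 * k + e - 1) = (- b2) ^ (2 * k + e)"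
  proof -
    have "Suc (2 * k + e - 1) = 2 * k + e" using assms(3) by simp
    then show ?thesis using power_Suc[of "- b2" "2 * k + e - 1"] by simp
  qed
  also have "\<dots> = (b2 ^ k)\<^sup>2 * (- b2) ^ e" 
  proof -
    have "((- b2) ^ k)\<^sup>2 = (b2 ^ k)\<^sup>2" by (cases "even k") auto
    then show ?thesis by (simp only: power_add power_even_eq)
  qed
  finally have "(b2 ^ k)\<^sup>2 * (b2 * resultant F ?H) = (b2 ^ k)\<^sup>2 * (- (u * v) * (- b2) ^ e * (b0 * \<gamma>\<^sup>2 - b2 * \<delta>\<^sup>2))"
    by (simp add: algebra_simps)
  then have main: "b2 * resultant F ?H = - (u * v) * (- b2) ^ e * (b0 * \<gamma>\<^sup>2 - b2 * \<delta>\<^sup>2)"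
    by (rule iffD1[OF mult_left_cancel, rotated]) (use b2 in simp)
  show ?thesis
    unfolding main by (rule bexI[of _ "- (u * v) * (- 1) ^ e"]) (use u(1) v(1) in \<open>auto simp: power_minus[of b2] minus_one_power_iff\<close>)
qed

text \<open>Substituting b0 for b2 T^2 in b2^k times the derivative T^(2k) + 2 b2 T + b1 leaves a
  linear remainder with slope 2 b2^(k+1). The factor b2 is then common to both sides of
  \<open>resultant_reduce_quadratic\<close> and cancels.\<close>

lemma monic_discriminant_char_dvd_pred_degree_even:
  fixes b0 b1 b2 :: "'a::idom"
  assumes d1: "of_nat d = (1::'a)" and d: "4 \<le> d" and nz: "2 * b2 \<noteq> 0" and k: "d - 1 = 2 * k"
  shows "\<exists>u\<in>{1, - 1}. monic_discriminant (Polynomial.monom 1 d + [:b0, b1, b2:])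
    = u * ((b0 ^ k + b2 ^ k * b1)\<^sup>2 - 4 * b2 ^ (2 * k + 1) * b0)"
proof -
  let ?F = "Polynomial.monom 1 (2 * k) + [:b1, 2 * b2:]"
  have b2: "b2 \<noteq> 0" and \<gamma>: "2 * b2 ^ (k + 1) \<noteq> 0" using nz by auto
  have k1: "1 \<le> k" using d k by simp
  have F: "Polynomial.degree ?F = 2 * k + 0"
    using monom_add_lower_monic(1)[OF degree_pCons_less(1), of "2 * k" b1 "2 * b2"] d k by linarith
  have eq: "Polynomial.smult (b2 ^ k) ?F = (Polynomial.monom (b2 ^ k) (2 * k) - [:b0 ^ k:]) * 1 + [:b0 ^ k + b2 ^ k * b1, 2 * b2 ^ (k + 1):]"
    by (simp add: smult_add_right smult_monom algebra_simps)
  obtain u where u: "u \<in> {1, - 1}" 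
    "b2 * resultant ?F [:b0, 0, - b2:] = u * b2 ^ 0 * (b0 * (2 * b2 ^ (k + 1))\<^sup>2 - b2 * (b0 ^ k + b2 ^ k * b1)\<^sup>2)"
    using resultant_reduce_quadratic[OF F zero_le_one k1 b2 \<gamma> eq] by blast
  define y where "y = b2 ^ k"
  have y: "b2 ^ (k + 1) = b2 * y" "b2 ^ (2 * k + 1) = b2 * (y * y)" 
    by (simp_all add: y_def power_add mult_2)
  have "b2 * resultant ?F [:b0, 0, - b2:] = b2 * (- u * ((b0 ^ k + b2 ^ k * b1)\<^sup>2 - 4 * b2 ^ (2 * k + 1) * b0))"
    unfolding u(2) y y_def[symmetric] by (simp add: algebra_simps power2_eq_square)
  then have "resultant ?F [:b0, 0, - b2:] = - u * ((b0 ^ k + b2 ^ k * b1)\<^sup>2 - 4 * b2 ^ (2 * k + 1) * b0)"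
    by (rule iffD1[OF mult_left_cancel[OF b2]])
  moreover obtain v where "v \<in> {1, - 1}" "monic_discriminant (Polynomial.monom 1 d + [:b0, b1, b2:])
    = v * resultant ?F [:b0, 0, - b2:]"
    using monic_discriminant_char_dvd_pred_degree[OF d1 d b2, unfolded k] by blast
  ultimately show ?thesis using u by (intro bexI[of _ "v * - u"]) auto
qed

text \<open>Now one T is left over from T^(2k+1), so b0^k joins the slope of the remainder and the
  constant term is b2^k b1. The second condition in \<open>nz\<close> keeps the remainder
  linear.\<close>

lemma monic_discriminant_char_dvd_pred_degree_odd:
  fixes b0 b1 b2 :: "'a::idom"
  assumes d1: "of_nat d = (1::'a)" and d: "4 \<le> d" and k: "d - 1 = 2 * k + 1"
    and nz: "b2 \<noteq> 0" "b0 ^ k + 2 * b2 ^ (k + 1) \<noteq> 0"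
  shows "\<exists>u\<in>{1, - 1}. monic_discriminant (Polynomial.monom 1 d + [:b0, b1, b2:])
    = u * (b2 ^ (2 * k + 1) * b1\<^sup>2 - b0 * (b0 ^ k + 2 * b2 ^ (k + 1))\<^sup>2)"
proof -
  let ?F = "Polynomial.monom 1 (2 * k + 1) + [:b1, 2 * b2:]"
  have k1: "1 \<le> k" using d k by simp
  have F: "Polynomial.degree ?F = 2 * k + 1"
    using monom_add_lower_monic(1)[OF degree_pCons_less(1), of "2 * k + 1" b1 "2 * b2"] d k by linarith
  have eq: "Polynomial.smult (b2 ^ k) ?F = (Polynomial.monom (b2 ^ k) (2 * k) - [:b0 ^ k:]) * [:0, 1:] + [:b2 ^ k * b1, b0 ^ k + 2 * b2 ^ (k + 1):]"
    by (simp add: smult_add_right smult_monom monom_Suc algebra_simps)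
  obtain u where u: "u \<in> {1, - 1}" 
    "b2 * resultant ?F [:b0, 0, - b2:] = u * b2 ^ 1 * (b0 * (b0 ^ k + 2 * b2 ^ (k + 1))\<^sup>2 - b2 * (b2 ^ k * b1)\<^sup>2)"
    using resultant_reduce_quadratic[OF F order_refl k1 nz eq] by blast
  define y where "y = b2 ^ k"
  have y: "b2 ^ (k + 1) = b2 * y" "b2 ^ (2 * k + 1) = b2 * (y * y)" 
    by (simp_all add: y_def power_add mult_2)
  have "b2 * resultant ?F [:b0, 0, - b2:] = b2 * (- u * (b2 ^ (2 * k + 1) * b1\<^sup>2 - b0 * (b0 ^ k + 2 * b2 ^ (k + 1))\<^sup>2))"
    unfolding u(2) y y_def[symmetric] by (simp add: algebra_simps power2_eq_square)
  then have "resultant ?F [:b0, 0, - b2:] = - u * (b2 ^ (2 * k + 1) * b1\<^sup>2 - b0 * (b0 ^ k + 2 * b2 ^ (k + 1))\<^sup>2)"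
    by (rule iffD1[OF mult_left_cancel[OF nz(1)]])
  moreover obtain v where "v \<in> {1, - 1}" "monic_discriminant (Polynomial.monom 1 d + [:b0, b1, b2:])
    = v * resultant ?F [:b0, 0, - b2:]"
    using monic_discriminant_char_dvd_pred_degree[OF d1 d nz(1), unfolded k] by blast
  ultimately show ?thesis using u by (intro bexI[of _ "v * - u"]) auto
qed

section \<open>Nested polynomials: the outermost variable is the main one, the middle one (called z
  below) stands for \<open>B_2\<close>\<close>

section \<open>Factors of trivariate polynomials\<close>

text \<open>Count the zeros at 0: all n of them must lie in \<open>q\<close>, which leaves no degree
  for \<open>p\<close>.\<close>

lemma degree_0_if_mult_eq_monom:
  fixes p q :: "'a::idom Polynomial.poly"
  assumes eq: "p * q = Polynomial.monom c n" and c: "c \<noteq> 0" and p0: "Polynomial.coeff p 0 \<noteq> 0"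
  shows "Polynomial.degree p = 0"
proof -
  have "p * q \<noteq> 0" using eq c by simp
  then have nz: "p \<noteq> 0" "q \<noteq> 0" by auto
  have "order 0 p + order 0 q = n"
    using order_mult[OF \<open>p * q \<noteq> 0\<close>, of 0] eq c by simp
  moreover have "order 0 p = 0" using p0 by (simp add: order_0I poly_0_coeff_0)
  moreover have "order 0 q \<le> Polynomial.degree q" using nz by (intro order_degree)
  moreover have "Polynomial.degree p + Polynomial.degree q = n"
    using degree_mult_eq[OF nz] eq c by (simp add: Polynomial.degree_monom_eq)
  ultimately show ?thesis by simp
qed

text \<open>A factor free of the main variable divides the leading coefficient \<alpha> z^n. By
  \<open>low\<close> it is not divisible by z, so it is free of z as well, and then it divides the
  constant \<alpha>.\<close>

lemma constant_factor_if_degree_0: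
  fixes P Q :: "'k::field Polynomial.poly Polynomial.poly Polynomial.poly"
  assumes lead: "Polynomial.lead_coeff (P * Q) = Polynomial.monom [:\<alpha>:] n" and \<alpha>: "\<alpha> \<noteq> 0"
    and low: "Polynomial.coeff (Polynomial.coeff (P * Q) 0) 0 \<noteq> 0"
    and deg: "Polynomial.degree P = 0"
  shows "\<exists>\<kappa>. P = [:[:[:\<kappa>:]:]:]"
proof -
  obtain p where P: "P = [:p:]" using deg degree_0_id by metis
  have PQ: "P * Q = Polynomial.smult p Q" by (simp add: P)
  have "p * Polynomial.lead_coeff Q = Polynomial.monom [:\<alpha>:] n"
    using lead unfolding PQ by (cases "p = 0") auto
  moreover have "Polynomial.coeff p 0 \<noteq> 0"
    using low unfolding PQ by (auto simp: coeff_mult)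
  ultimately have "Polynomial.degree p = 0" 
    using \<alpha> degree_0_if_mult_eq_monom [of p _ "[:\<alpha>:]" n] by simp
  then obtain p' where p: "p = [:p':]" using degree_0_id by metis
  have "p' * Polynomial.coeff (Polynomial.lead_coeff Q) n = [:\<alpha>:]"
    using arg_cong[OF \<open>p * Polynomial.lead_coeff Q = _\<close>, of "\<lambda>r. Polynomial.coeff r n"] by (simp add: p)
  then have "p' dvd [:\<alpha>:]" by (metis dvd_triv_left)
  then have "Polynomial.degree p' \<le> 0" using dvd_imp_degree_le[of p' "[:\<alpha>:]"] \<alpha> by simp
  then obtain \<kappa> where "p' = [:\<kappa>:]" using degree_0_id by (metis le_zero_eq)
  then show ?thesis using P p by blast
qed

lemma linear_factor_constant:
  fixes P Q :: "'k::field Polynomial.poly Polynomial.poly Polynomial.poly"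
  assumes PQ: "P * Q = [:e0, Polynomial.monom [:\<alpha>:] n:]" and \<alpha>: "\<alpha> \<noteq> 0"
    and low: "Polynomial.coeff e0 0 \<noteq> 0"
  shows "(\<exists>\<kappa>. P = [:[:[:\<kappa>:]:]:]) \<or> (\<exists>\<kappa>. Q = [:[:[:\<kappa>:]:]:])"
proof -
  have lead: "Polynomial.lead_coeff (P * Q) = Polynomial.monom [:\<alpha>:] n"
    and low': "Polynomial.coeff (Polynomial.coeff (P * Q) 0) 0 \<noteq> 0"
    using \<alpha> low unfolding PQ by auto
  have "P * Q \<noteq> 0" "Polynomial.degree (P * Q) = 1" using \<alpha> unfolding PQ by auto
  then have "Polynomial.degree P + Polynomial.degree Q = 1"
    by (metis degree_mult_eq mult_zero_left mult_zero_right)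
  then have "Polynomial.degree P = 0 \<or> Polynomial.degree Q = 0" by linarith
  then show ?thesis
    using constant_factor_if_degree_0[of P Q] constant_factor_if_degree_0[of Q P] lead low' \<alpha>
    by (metis mult.commute)
qed

text \<open>If both factors were linear in the main variable, the discriminant of the product would
  be the square of p0 q1 - p1 q0 and have even degree in z.\<close>

lemma quadratic_factor_constant:
  fixes P Q :: "'k::field Polynomial.poly Polynomial.poly Polynomial.poly"
  assumes PQ: "P * Q = [:e0, e1, Polynomial.monom [:\<alpha>:] n:]" and \<alpha>: "\<alpha> \<noteq> 0"
    and low: "Polynomial.coeff e0 0 \<noteq> 0"
    and disc: "odd (Polynomial.degree (e1\<^sup>2 - 4 * Polynomial.monom [:\<alpha>:] n * e0))"
  shows "(\<exists>\<kappa>. P = [:[:[:\<kappa>:]:]:]) \<or> (\<exists>\<kappa>. Q = [:[:[:\<kappa>:]:]:])"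
proof -
  have lead: "Polynomial.lead_coeff (P * Q) = Polynomial.monom [:\<alpha>:] n"
    and low': "Polynomial.coeff (Polynomial.coeff (P * Q) 0) 0 \<noteq> 0"
    using \<alpha> low unfolding PQ by auto
  have "P * Q \<noteq> 0" "Polynomial.degree (P * Q) = 2" using \<alpha> unfolding PQ by auto
  then have deg: "Polynomial.degree P + Polynomial.degree Q = 2"
    by (metis degree_mult_eq mult_zero_left mult_zero_right)
  have "\<not> (Polynomial.degree P = 1 \<and> Polynomial.degree Q = 1)"
  proof
    assume "Polynomial.degree P = 1 \<and> Polynomial.degree Q = 1"
    then obtain p0 p1 q0 q1 where P: "P = [:p0, p1:]" and Q: "Q = [:q0, q1:]"
      by (metis degree1_coeffs)
    have "p0 * q0 = e0" "p0 * q1 + p1 * q0 = e1" "p1 * q1 = Polynomial.monom [:\<alpha>:] n"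
      using PQ unfolding P Q by (auto simp: algebra_simps)
    then have "(p0 * q1 - p1 * q0)\<^sup>2 = e1\<^sup>2 - 4 * Polynomial.monom [:\<alpha>:] n * e0"
      by (auto simp: power2_eq_square algebra_simps)
    moreover have "even (Polynomial.degree ((p0 * q1 - p1 * q0)\<^sup>2))"
      by (cases "p0 * q1 - p1 * q0 = 0") (simp_all add: degree_power_eq)
    ultimately show False using disc by simp
  qed
  then have "Polynomial.degree P = 0 \<or> Polynomial.degree Q = 0" using deg by linarith
  then show ?thesis
    using constant_factor_if_degree_0[of P Q] constant_factor_if_degree_0[of Q P] lead low' \<alpha>
    by (metis mult.commute)
qed

section \<open>Weights as degrees in an auxiliary variable\<close>

section \<open>The weight grading\<close>

text \<open>Turns a nonvanishing specialization into the occurrence of a monomial: every monomial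
  containing an indeterminate sent to 0 contributes 0.\<close>

lemma (in comm_ring_hom) mp_eval_nonzeroD:
  assumes "mp_eval hom x p \<noteq> 0"
  obtains m where "m \<in> Poly_Mapping.keys p" "\<And>i. i \<in> Poly_Mapping.keys m \<Longrightarrow> x i \<noteq> 0"
proof -
  obtain m where m: "m \<in> Poly_Mapping.keys p" "monomial_value x m \<noteq> 0"
  proof (rule ccontr)
    assume "\<not> thesis"
    then have "monomial_value x m = 0" if "m \<in> Poly_Mapping.keys p" for m
      using that \<open>\<And>m. m \<in> Poly_Mapping.keys p \<Longrightarrow> monomial_value x m \<noteq> 0 \<Longrightarrow> thesis\<close> by blast
    then show False using assms by (simp add: mp_eval_def)
  qed
  have "x i \<noteq> 0" if i: "i \<in> Poly_Mapping.keys m" for i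
  proof
    assume "x i = 0"
    then have "x i ^ Poly_Mapping.lookup m i = 0" using i by (simp add: in_keys_iff zero_power)
    then have "monomial_value x m = 0"
      unfolding monomial_value_def using i by (intro prod_zero) auto
    then show False using m by blast
  qed
  then show ?thesis using m that by blast
qed

lemma comm_ring_hom_const_poly:
  assumes "comm_ring_hom h"
  shows "comm_ring_hom (\<lambda>c. [:h c:])"
proof -
  interpret comm_ring_hom h by fact
  show ?thesis by unfold_locales (auto simp: hom_add hom_mult)
qed

text \<open>Substitutes \<open>B_i\<close> S^(d-i) for \<open>B_i\<close> with a new variable S; the
  coefficient of S^w is the component of weight w. As a ring homomorphism into polynomials over a
  domain, it makes degree arguments available for weights.\<close>

definition grade :: "nat \<Rightarrow> 'k::comm_ring_1 multi_poly \<Rightarrow> 'k multi_poly Polynomial.poly"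
  where "grade d = mp_eval (\<lambda>c. [:mp_const c:]) (\<lambda>i. Polynomial.monom (mp_var i) (d - i))"

lemma comm_ring_hom_grade: "comm_ring_hom (grade d)"
  unfolding grade_def
  by (intro comm_ring_hom.comm_ring_hom_mp_eval comm_ring_hom_const_poly comm_ring_hom_mp_const)

lemma grade_eq_sum:
  "grade d p = (\<Sum>m\<in>Poly_Mapping.keys p. Polynomial.monom (Poly_Mapping.single m (Poly_Mapping.lookup p m)) (weight d m))"
  unfolding grade_def mp_eval_def monomial_value_weighted monomial_value_mp_var
  by (intro sum.cong refl) (simp add: mp_const_def smult_monom mult_single)

lemma lookup_coeff_grade:
  "Poly_Mapping.lookup (Polynomial.coeff (grade d p) w) m = (if weight d m = w then Poly_Mapping.lookup p m else 0)"
proof -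
  have "Poly_Mapping.lookup (Polynomial.coeff (grade d p) w) m
    = (\<Sum>m'\<in>Poly_Mapping.keys p. if m' = m then if weight d m = w then Poly_Mapping.lookup p m else 0 else 0)"
    unfolding grade_eq_sum coeff_sum lookup_sum
    by (intro sum.cong refl) (auto simp: lookup_single when_def)
  also have "\<dots> = (if weight d m = w then Poly_Mapping.lookup p m else 0)"
    by (simp add: in_keys_iff)
  finally show ?thesis .
qed

lemma weight_top_coeff:
  assumes "m \<in> Poly_Mapping.keys (Polynomial.lead_coeff (grade d p))"
  shows "weight d m = Polynomial.degree (grade d p)"
  using assms by (auto simp: in_keys_iff lookup_coeff_grade split: if_splits)

lemma weight_le_degree_grade:
  assumes "m \<in> Poly_Mapping.keys p"
  shows "weight d m \<le> Polynomial.degree (grade d p)"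
proof (rule le_degree)
  have "Poly_Mapping.lookup (Polynomial.coeff (grade d p) (weight d m)) m \<noteq> 0"
    using assms by (simp add: lookup_coeff_grade in_keys_iff)
  then show "Polynomial.coeff (grade d p) (weight d m) \<noteq> 0" by auto
qed

lemma mp_carrier_iff:
  "p \<in> carrier (mp_ring n) \<longleftrightarrow> (\<forall>m\<in>Poly_Mapping.keys p. Poly_Mapping.keys m \<subseteq> {..<n})"
  by (simp add: mp_ring_def)

text \<open>Every indeterminate allowed has index below \<open>d\<close>, hence positive weight, so
  only the trivial monomial has weight 0.\<close>

lemma constant_if_degree_grade_0:
  assumes "p \<in> carrier (mp_ring n)" "n \<le> d" "Polynomial.degree (grade d p) = 0"
  shows "\<exists>c. p = mp_const c"
proof -
  have "m = 0" if m: "m \<in> Poly_Mapping.keys p" for m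
  proof -
    have "weight d m = 0" using weight_le_degree_grade[OF m, of d] assms(3) by simp
    then have 1: "(d - i) * Poly_Mapping.lookup m i = 0" if "i \<in> Poly_Mapping.keys m" for i
      using that by (simp add: weight_def)
    have 2: "i < d" if "i \<in> Poly_Mapping.keys m" for i
      using that m assms(1,2) by (fastforce simp: mp_carrier_iff)
    have "i \<notin> Poly_Mapping.keys m" for i
      using 1[of i] 2[of i] by (cases "i \<in> Poly_Mapping.keys m") (auto simp: in_keys_iff)
    then show ?thesis by (metis equals0I keys_eq_empty)
  qed
  then have "p = mp_const (Poly_Mapping.lookup p 0)"
    by (intro poly_mapping_eqI) (auto simp: mp_const_def lookup_single when_def in_keys_iff)
  then show ?thesis by blast
qed

lemma mp_const_Units:
  fixes c :: "'k::field"
  assumes "c \<noteq> 0"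
  shows "mp_const c \<in> Units (mp_ring n)"
proof -
  have "mp_const b \<in> carrier (mp_ring n)" for b :: 'k
    by (auto simp: mp_carrier_iff mp_const_def split: if_splits)
  moreover have "mp_const c * mp_const (inverse c) = 1"
    using assms by (simp add: mp_const_def mult_single)
  ultimately show ?thesis
    unfolding Units_def
    by (auto simp: mp_ring_def ring_of_type_algebra_def mult.commute intro!: exI[of _ "mp_const (inverse c)"])
qed

text \<open>Sending the indeterminates of index at least \<open>n\<close> to 0 maps everything into
  the subring, so fixed points lie there. This proves membership without inspecting
  determinants.\<close>

lemma carrier_if_projection_fixed:
  fixes p :: "'k::comm_ring_1 multi_poly"
  assumes "mp_eval mp_const (\<lambda>i. if i < n then mp_var i else 0) p = p"
  shows "p \<in> carrier (mp_ring n)"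
proof -
  let ?x = "\<lambda>i. if i < n then mp_var i else 0 :: 'k multi_poly"
  have v: "monomial_value ?x m = (if Poly_Mapping.keys m \<subseteq> {..<n} then Poly_Mapping.single m 1 else 0)" for m
  proof (cases "Poly_Mapping.keys m \<subseteq> {..<n}")
    case True
    then have "monomial_value ?x m = monomial_value mp_var m"
      unfolding monomial_value_def by (intro prod.cong) auto
    then show ?thesis using True by (simp add: monomial_value_mp_var)
  next
    case False
    then obtain i where "i \<in> Poly_Mapping.keys m" "\<not> i < n" by auto
    then have "monomial_value ?x m = 0"
      unfolding monomial_value_def by (intro prod_zero) (auto simp: in_keys_iff zero_power intro!: bexI[of _ i])
    then show ?thesis using False by simp
  qed
  have "Poly_Mapping.keys (mp_const c * monomial_value ?x m) \<subseteq> {m. Poly_Mapping.keys m \<subseteq> {..<n}}" for c m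
    unfolding v by (auto simp: mp_const_def mult_single split: if_splits)
  then have "Poly_Mapping.keys (mp_eval mp_const ?x p) \<subseteq> {m. Poly_Mapping.keys m \<subseteq> {..<n}}"
    unfolding mp_eval_def by (intro order_trans[OF Poly_Mapping.keys_sum] UN_least)
  then show ?thesis unfolding assms mp_carrier_iff by auto
qed

section \<open>The top part of the discriminant and its specializations\<close>

lemma idom_hom_of_comm_ring_hom: "comm_ring_hom h \<Longrightarrow> idom_hom h"
  for h :: "'a::idom \<Rightarrow> 'b::idom"
  by (simp add: idom_hom_def)

text \<open>With \<open>n = d - s\<close> this is the family polynomial with all the
  \<open>a_i\<close> replaced by 0.\<close>

definition generic_poly :: "nat \<Rightarrow> nat \<Rightarrow> 'k::idom multi_poly Polynomial.poly"
  where "generic_poly d n = Polynomial.monom 1 d + (\<Sum>i<n. Polynomial.monom (mp_var i) i)"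

lemma coeff_generic_poly:
  assumes "n < d"
  shows "Polynomial.coeff (generic_poly d n) i = (if i = d then 1 else if i < n then mp_var i else 0)"
  using assms by (auto simp: generic_poly_def coeff_sum)

lemma generic_poly_monic:
  fixes n d :: nat
  defines "f \<equiv> generic_poly d n :: 'k::idom multi_poly Polynomial.poly"
  assumes "n < d"
  shows "Polynomial.degree f = d" "Polynomial.lead_coeff f = 1"
proof -
  have "Polynomial.degree f \<le> d"
    using assms by (intro degree_le) (auto simp: coeff_generic_poly)
  moreover have "d \<le> Polynomial.degree f"
    using assms by (intro le_degree) (simp add: coeff_generic_poly)
  ultimately show d: "Polynomial.degree f = d" by simp
  show "Polynomial.lead_coeff f = 1"
    unfolding d using assms by (simp add: coeff_generic_poly)
qed

lemma coeff_family_poly: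
  "Polynomial.coeff (family_poly d s a) i =
    (if i = d then 1 else if i < d - s then mp_var i else if i < d then mp_const (a i) else 0)"
  by (auto simp: family_poly_def coeff_sum)

text \<open>The grading commutes with the discriminant. The constants \<open>a_i\<close> keep degree
  0, strictly below the bound d - i, so they vanish on passing to top coefficients, while each
  \<open>B_i\<close> attains its bound.\<close>

lemma grade_discriminant:
  fixes a :: "nat \<Rightarrow> 'k::idom"
  assumes "1 \<le> s" "s \<le> d"
  shows "Polynomial.degree (grade d (monic_discriminant (family_poly d s a))) \<le> d * (d - 1)"
    and "Polynomial.coeff (grade d (monic_discriminant (family_poly d s a))) (d * (d - 1))
      = monic_discriminant (generic_poly d (d - s))"
proof -
  let ?f = "family_poly d s a"
  interpret g: idom_hom "grade d :: 'k multi_poly \<Rightarrow> _"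
    by (intro idom_hom_of_comm_ring_hom comm_ring_hom_grade)
  have eq: "grade d (monic_discriminant ?f) = monic_discriminant (map_poly (grade d) ?f)"
    using family_poly_monic(2) by (rule g.monic_discriminant_map_poly[symmetric])
  have D: "Polynomial.degree (map_poly (grade d) ?f) = d"
    using family_poly_monic[of d s a] by (subst degree_map_poly) auto
  have n: "d - s < d" using assms by simp
  have gv: "grade d (mp_var i :: 'k multi_poly) = Polynomial.monom (mp_var i) (d - i)"
    and gc: "grade d (mp_const c :: 'k multi_poly) = [:mp_const c:]" for i c
    unfolding grade_def
    by (simp_all add: comm_ring_hom.mp_eval_var comm_ring_hom.mp_eval_const comm_ring_hom_const_poly comm_ring_hom_mp_const)
  have "Polynomial.degree (Polynomial.coeff (map_poly (grade d) ?f) i) \<le> d - i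
    \<and> Polynomial.coeff (Polynomial.coeff (map_poly (grade d) ?f) i) (d - i) = Polynomial.coeff (generic_poly d (d - s)) i"
    if "i \<le> d" for i
    using that n unfolding g.coeff_map_poly_hom coeff_family_poly coeff_generic_poly[OF n]
    by (auto simp: gv gc g.hom_one degree_monom_le coeff_pCons split: nat.splits)
  then show "Polynomial.degree (grade d (monic_discriminant ?f)) \<le> d * (d - 1)"
    "Polynomial.coeff (grade d (monic_discriminant ?f)) (d * (d - 1)) = monic_discriminant (generic_poly d (d - s))"
    unfolding eq using monic_discriminant_top_coeff[OF D generic_poly_monic(1)[OF n]] by auto
qed

text \<open>The projection fixes every coefficient of the family polynomial and commutes with the
  discriminant.\<close>

lemma discriminant_in_carrier:
  fixes a :: "nat \<Rightarrow> 'k::idom"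
  shows "monic_discriminant (family_poly d s a) \<in> carrier (mp_ring (d - s))"
proof (rule carrier_if_projection_fixed)
  let ?x = "\<lambda>i. if i < d - s then mp_var i else 0 :: 'k multi_poly"
  interpret g: idom_hom "mp_eval mp_const ?x"
    by (intro idom_hom_of_comm_ring_hom comm_ring_hom.comm_ring_hom_mp_eval comm_ring_hom_mp_const)
  have "map_poly (mp_eval mp_const ?x) (family_poly d s a) = family_poly d s a"
    by (intro poly_eqI) (auto simp: coeff_family_poly comm_ring_hom.mp_eval_var comm_ring_hom.mp_eval_const comm_ring_hom_mp_const)
  then show "mp_eval mp_const ?x (monic_discriminant (family_poly d s a)) = monic_discriminant (family_poly d s a)"
    using g.monic_discriminant_map_poly[OF family_poly_monic(2), of d s a] by simp
qed

text \<open>The assignment is the coefficient sequence of \<open>q\<close>, so it specializes the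
  generic polynomial to T^d + q; the bound on the degree of \<open>q\<close> says that only free
  coefficients are used.\<close>

lemma mp_eval_generic_discriminant:
  fixes h :: "'k::idom \<Rightarrow> 'r::idom"
  assumes "comm_ring_hom h" "n < d" "Polynomial.degree q < n"
  shows "mp_eval h (Polynomial.coeff q) (monic_discriminant (generic_poly d n)) = monic_discriminant (Polynomial.monom 1 d + q)"
proof -
  interpret h: comm_ring_hom h by fact
  interpret g: idom_hom "mp_eval h (Polynomial.coeff q)"
    by (intro idom_hom_of_comm_ring_hom h.comm_ring_hom_mp_eval)
  have "map_poly (mp_eval h (Polynomial.coeff q)) (generic_poly d n) = Polynomial.monom 1 d + q"
    using assms(2,3) by (intro poly_eqI) (auto simp: coeff_generic_poly h.mp_eval_var coeff_eq_0)
  then show ?thesis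
    using g.monic_discriminant_map_poly[OF generic_poly_monic(2)[OF assms(2)]] by simp
qed

lemma hom_mp_eval:
  assumes "comm_ring_hom g" "comm_ring_hom h"
  shows "g (mp_eval h x p) = mp_eval (\<lambda>c. g (h c)) (\<lambda>i. g (x i)) p"
proof -
  interpret g: comm_ring_hom g by fact
  show ?thesis
    by (simp add: mp_eval_def monomial_value_def g.hom_sum g.hom_mult g.hom_prod g.hom_power)
qed

text \<open>Setting the three remaining variables to 0 sends every \<open>x i\<close> to 0 but keeps
  \<kappa>. So the top part has a nonzero constant term, and being homogeneous it has weight
  0.\<close>

lemma degree_grade_0_if_constant_top:
  fixes p :: "'k::field multi_poly"
  assumes eq: "mp_eval (\<lambda>c. [:[:[:c:]:]:]) x (Polynomial.lead_coeff (grade d p)) = [:[:[:\<kappa>:]:]:]" and "\<kappa> \<noteq> 0"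
    and x: "\<And>i. Polynomial.coeff (Polynomial.coeff (Polynomial.coeff (x i) 0) 0) 0 = 0"
  shows "Polynomial.degree (grade d p) = 0"
proof -
  let ?R = "Polynomial.lead_coeff (grade d p)"
  let ?g = "\<lambda>r :: 'k Polynomial.poly Polynomial.poly Polynomial.poly. Polynomial.coeff (Polynomial.coeff (Polynomial.coeff r 0) 0) 0"
  have g: "comm_ring_hom ?g" by unfold_locales (auto simp: coeff_mult)
  have id: "comm_ring_hom (\<lambda>c :: 'k. c)" by unfold_locales auto
  have h: "comm_ring_hom (\<lambda>c :: 'k. [:[:[:c:]:]:])"
    by (intro comm_ring_hom_const_poly id)
  have "mp_eval (\<lambda>c. c) (\<lambda>i. 0) ?R = \<kappa>"
    using hom_mp_eval[OF g h, of x ?R] unfolding eq x by simp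
  then have "mp_eval (\<lambda>c. c) (\<lambda>i. 0) ?R \<noteq> 0" using \<open>\<kappa> \<noteq> 0\<close> by simp
  then obtain m where m: "m \<in> Poly_Mapping.keys ?R" "\<And>i. i \<in> Poly_Mapping.keys m \<Longrightarrow> (0::'k) \<noteq> 0"
    using comm_ring_hom.mp_eval_nonzeroD[OF id, of "\<lambda>i. 0" ?R] by blast
  then have "Poly_Mapping.keys m = {}" by blast
  then have "weight d m = 0" by (simp add: weight_def)
  then show ?thesis using weight_top_coeff[OF m(1)] by simp
qed

text \<open>A nonzero value with all indeterminates but \<open>B_i\<close> set to 0 forces a power
  of \<open>B_i\<close> in the top part, and the weight of that power is a multiple of d -
  i.\<close>

lemma pure_power_dvd_degree_grade:
  fixes p :: "'k::field multi_poly"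
  assumes "mp_eval (\<lambda>c. c) x (Polynomial.lead_coeff (grade d p)) \<noteq> 0" "\<And>j. j \<noteq> i \<Longrightarrow> x j = 0"
  shows "(d - i) dvd Polynomial.degree (grade d p)"
proof -
  have id: "comm_ring_hom (\<lambda>c :: 'k. c)" by unfold_locales auto
  obtain m where m: "m \<in> Poly_Mapping.keys (Polynomial.lead_coeff (grade d p))" "\<And>j. j \<in> Poly_Mapping.keys m \<Longrightarrow> x j \<noteq> 0"
    using comm_ring_hom.mp_eval_nonzeroD[OF id assms(1)] by blast
  have "j = i" if "j \<in> Poly_Mapping.keys m" for j
    using m(2)[OF that] assms(2)[of j] by blast
  then have "weight d m = (\<Sum>j\<in>Poly_Mapping.keys m. (d - i) * Poly_Mapping.lookup m j)"
    unfolding weight_def by (intro sum.cong) auto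
  then have "(d - i) dvd weight d m" by (simp flip: sum_distrib_left)
  then show ?thesis using weight_top_coeff[OF m(1)] by simp
qed

lemma two_poly_neq_0: "(2::'a::comm_ring_1 Polynomial.poly) \<noteq> 0" if "(2::'a) \<noteq> 0"
  using that by (simp add: numeral_poly)

text \<open>The main variable is \<open>B_0\<close>, the innermost one \<open>B_1\<close>. The
  leading coefficient is (2z)^d, and putting z = 0 in \<open>e0\<close> leaves a power of
  -\<open>B_1\<close>, so z does not divide \<open>e0\<close>.\<close>

lemma discriminant_linear_specialization:
  assumes "of_nat d = (0::'k::field)" "3 \<le> d" "(2::'k) \<noteq> 0"
  shows "\<exists>e0 \<alpha> n. \<exists>u\<in>{1, - 1}. \<alpha> \<noteq> 0 \<and> Polynomial.coeff e0 0 \<noteq> 0 \<and>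
    monic_discriminant (Polynomial.monom 1 d + [:[:0, 1:], [:[:[:0, 1:]:]:], [:[:0, 1:]:]:])
      = u * [:e0, Polynomial.monom [:\<alpha> :: 'k:] n:]"
proof -
  define y z where "y = [:[:0, 1::'k:]:]" and "z = [:0, 1 :: 'k Polynomial.poly:]"
  define e0 where "e0 = (- y) ^ d - (2 * z) ^ (d - 2) * z * y\<^sup>2"
  have "(2 :: 'k Polynomial.poly Polynomial.poly Polynomial.poly) \<noteq> 0"
    using assms(3) by (intro two_poly_neq_0)
  then have nz: "2 * [:z:] \<noteq> 0" by (simp add: z_def del: mult_pCons_left mult_pCons_right)
  have d0: "of_nat d = (0 :: 'k Polynomial.poly Polynomial.poly Polynomial.poly)"
    using assms(1) by (simp add: of_nat_poly)
  obtain u where u: "u \<in> {1, - 1}" "monic_discriminant (Polynomial.monom 1 d + [:[:0, 1:], [:y:], [:z:]:])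
    = u * ((2 * [:z:]) ^ d * [:0, 1:] - (2 * [:z:]) ^ (d - 2) * [:z:] * [:y:]\<^sup>2 + (- [:y:]) ^ d)"
    using monic_discriminant_char_dvd_degree[OF d0 assms(2) nz] by blast
  have "(2 * [:z:]) ^ d * [:0, 1:] - (2 * [:z:]) ^ (d - 2) * [:z:] * [:y:]\<^sup>2 + (- [:y:]) ^ d = [:e0, (2 * z) ^ d:]"
  proof -
    have "2 * [:z:] = [:2 * z:]" by (simp only: mult_2) simp
    then show ?thesis by (simp add: e0_def poly_const_pow)
  qed
  also have "2 * z = Polynomial.monom [:2:] 1" by (simp add: z_def monom_Suc monom_0 numeral_poly)
  also have "\<dots> ^ d = Polynomial.monom [:2 ^ d:] d" by (simp add: monom_power poly_const_pow)
  finally have 1: "monic_discriminant (Polynomial.monom 1 d + [:[:0, 1:], [:y:], [:z:]:]) = u * [:e0, Polynomial.monom [:2 ^ d:] d:]"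
    using u by simp
  have "poly e0 0 = (- [:0, 1:]) ^ d" by (simp add: e0_def y_def z_def poly_power)
  also have "\<dots> \<noteq> 0" by simp
  finally have "Polynomial.coeff e0 0 \<noteq> 0" by (simp add: poly_0_coeff_0)
  then show ?thesis
    unfolding y_def[symmetric] z_def[symmetric] using u(1) 1 assms(3)
    by (intro exI[of _ e0] exI[of _ "2 ^ d"] exI[of _ d] bexI[of _ u]) auto
qed

text \<open>The main variable is now \<open>B_1\<close>, the innermost one \<open>B_0\<close>. The
  parity of d - 1 decides the shape of the remainder modulo b0 - b2 T^2, hence the two
  formulas.\<close>

lemma discriminant_quadratic_specialization:
  assumes "of_nat d = (1::'k::field)" "4 \<le> d" "(2::'k) \<noteq> 0"
  shows "\<exists>e0 e1 \<alpha> n. \<exists>u\<in>{1, - 1}. \<alpha> \<noteq> 0 \<and> Polynomial.coeff e0 0 \<noteq> 0 \<and>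
    odd (Polynomial.degree (e1\<^sup>2 - 4 * Polynomial.monom [:\<alpha>:] n * e0)) \<and>
    monic_discriminant (Polynomial.monom 1 d + [:[:[:[:0, 1:]:]:], [:0, 1:], [:[:0, 1:]:]:])
      = u * [:e0, e1, Polynomial.monom [:\<alpha> :: 'k:] n:]"
proof -
  define x z where "x = [:[:0, 1::'k:]:]" and "z = [:0, 1 :: 'k Polynomial.poly:]"
  let ?D = "monic_discriminant (Polynomial.monom 1 d + [:[:x:], [:0, 1:], [:z:]:])"
  have two: "(2 :: 'k Polynomial.poly Polynomial.poly) \<noteq> 0"
    using assms(3) by (intro two_poly_neq_0)
  have z0: "z \<noteq> 0" and x0: "x \<noteq> 0" by (simp_all add: z_def x_def)
  have dz: "Polynomial.degree (z ^ m) = m" for m by (simp add: z_def degree_power_eq)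
  have zm: "z ^ m = Polynomial.monom [:1:] m" for m
  proof -
    have "z = Polynomial.monom 1 1" by (simp add: z_def monom_Suc monom_0)
    then show ?thesis by (simp add: monom_power)
  qed
  have d1: "of_nat d = (1 :: 'k Polynomial.poly Polynomial.poly Polynomial.poly)"
    using assms(1) by (simp add: of_nat_poly)
  show ?thesis
  proof (cases "even (d - 1)")
    case True
    then obtain k where k: "d - 1 = 2 * k" by (elim evenE)
    define e0 where "e0 = x ^ (2 * k) - 4 * z ^ (2 * k + 1) * x"
    define e1 where "e1 = 2 * x ^ k * z ^ k"
    have nz: "2 * [:z:] \<noteq> 0"
      using two_poly_neq_0[OF two] z0 by (simp del: mult_pCons_left mult_pCons_right)
    obtain u where u: "u \<in> {1, - 1}" "?D = u * (([:x:] ^ k + [:z:] ^ k * [:0, 1:])\<^sup>2 - 4 * [:z:] ^ (2 * k + 1) * [:x:])"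
      using monic_discriminant_char_dvd_pred_degree_even[OF d1 assms(2) nz k] by blast
    have "([:x:] ^ k + [:z:] ^ k * [:0, 1:])\<^sup>2 - 4 * [:z:] ^ (2 * k + 1) * [:x:] = [:e0, e1, z ^ (2 * k):]"
    proof -
      have p: "x ^ (2 * k) = x ^ k * x ^ k" "z ^ (2 * k + 1) = z * (z ^ k * z ^ k)" "z ^ (2 * k) = z ^ k * z ^ k"
        by (simp_all add: mult_2 power_add)
      show ?thesis
        unfolding e0_def e1_def poly_const_pow p
        by (simp add: power2_eq_square numeral_poly algebra_simps)
    qed
    then have D: "?D = u * [:e0, e1, Polynomial.monom [:1:] (2 * k):]" using u(2) unfolding zm by (simp only:)
    \<comment> \<open>The square of \<open>e1\<close> cancels against the first term of
      \<open>e0\<close>, which leaves 16 x z^(4k+1), of odd degree in z.\<close>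
    have "e1\<^sup>2 - 4 * z ^ (2 * k) * e0 = 2 ^ 4 * x * z ^ (4 * k + 1)"
    proof -
      define g h where "g = x ^ k" and "h = z ^ k"
      have p: "x ^ (2 * k) = g * g" "z ^ (2 * k + 1) = z * (h * h)" "z ^ (2 * k) = h * h" "z ^ (4 * k + 1) = z * (h * h * (h * h))"
      proof -
        have four: "4 * k = k + k + (k + k)" by simp
        show "z ^ (4 * k + 1) = z * (h * h * (h * h))"
          unfolding four by (simp add: h_def power_add)
      qed (simp_all add: g_def h_def mult_2 power_add)
      show ?thesis unfolding e0_def e1_def p g_def[symmetric] h_def[symmetric]
        by (simp add: power2_eq_square algebra_simps)
    qed
    also have "2 ^ 4 * x = [:[:0, 2 ^ 4:]:]" by (simp add: x_def numeral_poly poly_const_pow)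
    finally have "e1\<^sup>2 - 4 * z ^ (2 * k) * e0 = Polynomial.smult [:0, 2 ^ 4:] (z ^ (4 * k + 1))"
      by simp
    moreover have "[:0, 2 ^ 4 :: 'k:] \<noteq> 0"
      using power_not_zero[OF assms(3), of 4] by (simp only: pCons_eq_0_iff) simp
    ultimately have "Polynomial.degree (e1\<^sup>2 - 4 * z ^ (2 * k) * e0) = 4 * k + 1"
      by (simp only: degree_smult_eq dz if_False)
    then have disc: "odd (Polynomial.degree (e1\<^sup>2 - 4 * Polynomial.monom [:1:] (2 * k) * e0))"
      unfolding zm by simp
    have "poly e0 0 = [:0, 1:] ^ (2 * k)" by (simp add: e0_def x_def z_def poly_power)
    then have "Polynomial.coeff e0 0 \<noteq> 0" by (simp add: poly_0_coeff_0)
    then show ?thesis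
      unfolding x_def[symmetric] z_def[symmetric] using u(1) D disc
      by (intro exI[of _ e0] exI[of _ e1] exI[of _ 1] exI[of _ "2 * k"] bexI[of _ u]) auto
  next
    case False
    then obtain k where k: "d - 1 = 2 * k + 1" by (elim oddE)
    \<comment> \<open>The slope of the linear remainder. It has degree k + 1 in z, so the
      discriminant 4 x z^(2k+1) w^2 has odd degree (2k+1) + 2(k+1).\<close>
    define w where "w = x ^ k + 2 * z ^ (k + 1)"
    have "Polynomial.coeff w (k + 1) = 2"
    proof -
      have "x ^ k = [:[:0, 1:] ^ k:]" by (simp add: x_def poly_const_pow)
      moreover have "2 * z ^ (k + 1) = Polynomial.monom 2 (k + 1)"
        unfolding zm by (simp add: numeral_poly smult_monom)
      ultimately show ?thesis by (simp add: w_def)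
    qed
    moreover have dw: "Polynomial.degree w = k + 1"
    proof -
      have "x ^ k = [:[:0, 1:] ^ k:]" by (simp add: x_def poly_const_pow)
      moreover have "Polynomial.degree (2 * z ^ (k + 1)) = k + 1"
        using two dz[of "k + 1"] z0 by (simp add: degree_mult_eq)
      ultimately show ?thesis unfolding w_def by (subst degree_add_eq_right) auto
    qed
    ultimately have w0: "w \<noteq> 0" by auto
    have w: "[:x:] ^ k + 2 * [:z:] ^ (k + 1) = [:w:]"
      unfolding w_def mult_2 poly_const_pow by simp
    then have nz: "[:z:] \<noteq> 0" "[:x:] ^ k + 2 * [:z:] ^ (k + 1) \<noteq> 0"
      using z0 w0 by simp_all
    define e0 where "e0 = - (x * w\<^sup>2)"
    obtain u where u: "u \<in> {1, - 1}" "?D = u * ([:z:] ^ (2 * k + 1) * [:0, 1:]\<^sup>2 - [:x:] * ([:x:] ^ k + 2 * [:z:] ^ (k + 1))\<^sup>2)"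
      using monic_discriminant_char_dvd_pred_degree_odd[OF d1 assms(2) k nz] by blast
    have "[:z:] ^ (2 * k + 1) * [:0, 1:]\<^sup>2 - [:x:] * ([:x:] ^ k + 2 * [:z:] ^ (k + 1))\<^sup>2 = [:e0, 0, z ^ (2 * k + 1):]"
      unfolding w unfolding e0_def poly_const_pow by (simp add: power2_eq_square)
    then have D: "?D = u * [:e0, 0, Polynomial.monom [:1:] (2 * k + 1):]" using u(2) unfolding zm by (simp only:)
    have "0\<^sup>2 - 4 * g * (- ([:[:0, 1:]:] * h)) = Polynomial.smult [:0, 4:] (g * h)" for g h :: "'k Polynomial.poly Polynomial.poly"
      by (simp add: numeral_poly)
    then have "0\<^sup>2 - 4 * z ^ (2 * k + 1) * e0 = Polynomial.smult [:0, 4:] (z ^ (2 * k + 1) * w\<^sup>2)"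
      unfolding e0_def x_def .
    moreover have "[:0, 4 :: 'k:] \<noteq> 0"
    proof -
      have "(4 :: 'k) = 2 * 2" by simp
      then have "(4 :: 'k) \<noteq> 0" using assms(3) by (simp only: mult_eq_0_iff) simp
      then show ?thesis by simp
    qed
    moreover have "Polynomial.degree (z ^ (2 * k + 1) * w\<^sup>2) = (2 * k + 1) + 2 * (k + 1)"
    proof -
      have "Polynomial.degree (w\<^sup>2) = 2 * (k + 1)" using degree_power_eq[OF w0, of 2] dw by simp
      then show ?thesis
        using degree_mult_eq[of "z ^ (2 * k + 1)" "w\<^sup>2"] dz[of "2 * k + 1"] w0 z0 by (metis power_not_zero)
    qed
    ultimately have "Polynomial.degree (0\<^sup>2 - 4 * z ^ (2 * k + 1) * e0) = (2 * k + 1) + 2 * (k + 1)"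
      by (simp only: degree_smult_eq if_False)
    then have disc: "odd (Polynomial.degree (0\<^sup>2 - 4 * Polynomial.monom [:1:] (2 * k + 1) * e0))"
      unfolding zm by simp
    have "k \<noteq> 0" using k assms(2) by auto
    have "poly e0 0 = - ([:0, 1:] * ([:0, 1:] ^ k)\<^sup>2)" by (simp add: e0_def w_def x_def z_def poly_power)
    then have "Polynomial.coeff e0 0 \<noteq> 0" by (simp add: poly_0_coeff_0)
    then show ?thesis
      unfolding x_def[symmetric] z_def[symmetric] using u(1) D disc
      by (intro exI[of _ e0] exI[of _ 0] exI[of _ 1] exI[of _ "2 * k + 1"] bexI[of _ u]) auto
  qed
qed

section \<open>From factors of the top part to factors of the discriminant\<close>

section \<open>Irreducibility\<close>

text \<open>The two assumptions on \<open>w\<close> make it the exact degree of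
  \<open>grade d D\<close>; over a domain degrees add and leading coefficients multiply.\<close>

lemma lead_coeff_grade_mult:
  fixes P Q :: "'k::idom multi_poly"
  assumes D: "D = P * Q" and deg: "Polynomial.degree (grade d D) \<le> w" and top: "Polynomial.coeff (grade d D) w \<noteq> 0"
  shows "Polynomial.degree (grade d P) + Polynomial.degree (grade d Q) = w"
    and "Polynomial.lead_coeff (grade d P) * Polynomial.lead_coeff (grade d Q) = Polynomial.coeff (grade d D) w"
proof -
  interpret g: comm_ring_hom "grade d :: 'k multi_poly \<Rightarrow> _" by (rule comm_ring_hom_grade)
  have eq: "grade d D = grade d P * grade d Q" unfolding D by (rule g.hom_mult)
  have w: "Polynomial.degree (grade d D) = w" using deg le_degree[OF top] by simp
  have "grade d D \<noteq> 0" using top by auto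
  then have "grade d P \<noteq> 0" "grade d Q \<noteq> 0" unfolding eq by auto
  then show "Polynomial.degree (grade d P) + Polynomial.degree (grade d Q) = w"
    using w unfolding eq by (simp add: degree_mult_eq)
  show "Polynomial.lead_coeff (grade d P) * Polynomial.lead_coeff (grade d Q) = Polynomial.coeff (grade d D) w"
    unfolding w[symmetric] unfolding eq by (simp add: lead_coeff_mult)
qed

lemma comm_ring_hom_id: "comm_ring_hom (\<lambda>c :: 'k::comm_ring_1. c)"
  by unfold_locales auto

lemma comm_ring_hom_triple_const: "comm_ring_hom (\<lambda>c :: 'k::comm_ring_1. [:[:[:c:]:]:])"
  by (intro comm_ring_hom_const_poly comm_ring_hom_id)

text \<open>By coprimality \<open>w\<close> is a multiple of d(d-1), which it cannot exceed.\<close>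

lemma coprime_dvd_product_cases:
  fixes w w' :: nat
  assumes "d dvd w" "(d - 1) dvd w" "w + w' = d * (d - 1)" "2 \<le> d"
  shows "w = 0 \<or> w' = 0"
proof -
  have "coprime d (d - 1)" using assms(4) by (cases d) auto
  then have "d * (d - 1) dvd w" using assms(1,2) by (rule divides_mult[rotated 2])
  then have "w = 0 \<or> d * (d - 1) \<le> w" using dvd_imp_le by blast
  then show ?thesis using assms(3) by auto
qed

text \<open>By \<open>factor\<close> one of the two specialized top parts is constant, and it is
  nonzero because \<open>E\<close> is. The corresponding factor then has weight 0.\<close>

lemma constant_top_cases:
  fixes P Q :: "'k::field multi_poly"
  assumes PQ: "mp_eval (\<lambda>c. [:[:[:c:]:]:]) x (Polynomial.lead_coeff (grade d P))
      * mp_eval (\<lambda>c. [:[:[:c:]:]:]) x (Polynomial.lead_coeff (grade d Q)) = u * E"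
    and u: "u \<in> {1, - 1}" and E: "E \<noteq> 0"
    and x: "\<And>i. Polynomial.coeff (Polynomial.coeff (Polynomial.coeff (x i) 0) 0) 0 = 0"
    and factor: "\<And>p q. p * q = E \<Longrightarrow> (\<exists>\<kappa>. p = [:[:[:\<kappa>:]:]:]) \<or> (\<exists>\<kappa>. q = [:[:[:\<kappa>:]:]:])"
  shows "Polynomial.degree (grade d P) = 0 \<or> Polynomial.degree (grade d Q) = 0"
proof -
  let ?e = "\<lambda>P. mp_eval (\<lambda>c. [:[:[:c:]:]:]) x (Polynomial.lead_coeff (grade d P))"
  have nz: "?e P \<noteq> 0" "?e Q \<noteq> 0" using PQ u E by auto
  have zero: "Polynomial.degree (grade d R) = 0" if "?e R = [:[:[:\<kappa>:]:]:]" "?e R \<noteq> 0" for R \<kappa>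
    using that degree_grade_0_if_constant_top[OF that(1) _ x] by auto
  \<comment> \<open>The sign is its own inverse and is moved into the first factor.\<close>
  have "(u * ?e P) * ?e Q = E" using PQ u by auto
  from factor[OF this] consider \<kappa> where "u * ?e P = [:[:[:\<kappa>:]:]:]" | \<kappa> where "?e Q = [:[:[:\<kappa>:]:]:]" by blast
  then show ?thesis
  proof cases
    case 1
    then have "?e P = [:[:[:\<kappa>:]:]:] \<or> ?e P = [:[:[:- \<kappa>:]:]:]"
      using u by (auto simp: minus_equation_iff[of "?e P"])
    then show ?thesis using zero[of P \<kappa>] zero[of P "- \<kappa>"] nz(1) by auto
  next
    case 2
    then show ?thesis using zero[OF 2 nz(2)] by simp
  qed
qed

lemma mp_eval_lead_coeff_grade_mult:
  fixes P Q :: "'k::idom multi_poly" and h :: "'k \<Rightarrow> 'r::idom"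
  assumes "comm_ring_hom h" "Polynomial.degree (grade d (P * Q)) \<le> w" "Polynomial.coeff (grade d (P * Q)) w \<noteq> 0"
  shows "mp_eval h x (Polynomial.lead_coeff (grade d P)) * mp_eval h x (Polynomial.lead_coeff (grade d Q))
    = mp_eval h x (Polynomial.coeff (grade d (P * Q)) w)"
proof -
  interpret e: comm_ring_hom "mp_eval h x" by (rule comm_ring_hom.comm_ring_hom_mp_eval[OF assms(1)])
  show ?thesis
    unfolding lead_coeff_grade_mult(2)[OF refl assms(2,3), symmetric] by (rule e.hom_mult[symmetric])
qed

text \<open>The gap of 3 between \<open>s\<close> and \<open>d\<close> guarantees that
  \<open>B_0\<close>, \<open>B_1\<close>, \<open>B_2\<close> are free; all other indeterminates are
  set to 0.\<close>

lemma mp_eval_top_discriminant: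
  fixes a :: "nat \<Rightarrow> 'k::idom" and h :: "'k \<Rightarrow> 'r::idom"
  assumes "comm_ring_hom h" "1 \<le> s" "s + 3 \<le> d"
  shows "mp_eval h (Polynomial.coeff [:b0, b1, b2:])
      (Polynomial.coeff (grade d (monic_discriminant (family_poly d s a))) (d * (d - 1)))
    = monic_discriminant (Polynomial.monom 1 d + [:b0, b1, b2:])"
proof -
  have "s \<le> d" using assms(3) by simp
  show ?thesis
    unfolding grade_discriminant(2)[OF assms(2) \<open>s \<le> d\<close>] using assms(2,3)
    by (intro mp_eval_generic_discriminant[OF assms(1)] degree_pCons_less(2)) auto
qed

lemma discriminant_factor_degree_grade_0:
  fixes a :: "nat \<Rightarrow> 'k::field"
  assumes two: "(2::'k) \<noteq> 0" and s: "1 \<le> s" "s + 3 \<le> d"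
  defines "D \<equiv> monic_discriminant (family_poly d s a)"
  shows "Polynomial.degree (grade d D) = d * (d - 1)
    \<and> (\<forall>P Q. D = P * Q \<longrightarrow> Polynomial.degree (grade d P) = 0 \<or> Polynomial.degree (grade d Q) = 0)"
proof -
  define T where "T = Polynomial.coeff (grade d D) (d * (d - 1))"
  have d3: "3 \<le> d" and d4: "4 \<le> d" and "s \<le> d" using s by simp_all
  note le = grade_discriminant(1)[OF s(1) \<open>s \<le> d\<close>, of a, folded D_def]
  note spec = mp_eval_top_discriminant[OF _ s, of _ _ _ _ a, folded D_def, folded T_def]
  note mult = mp_eval_lead_coeff_grade_mult[where d = d and w = "d * (d - 1)"]
  let ?c = "\<lambda>c :: 'k. [:[:[:c:]:]:]"
  have "T \<noteq> 0 \<and> (\<forall>P Q. D = P * Q \<longrightarrow> Polynomial.degree (grade d P) = 0 \<or> Polynomial.degree (grade d Q) = 0)"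
  \<comment> \<open>When d and d - 1 are both invertible, divisibility of weights suffices;
    otherwise the derivative degenerates and an explicit irreducible specialization is
    available.\<close>
  proof (cases "of_nat d = (0::'k) \<or> of_nat (d - 1) = (0::'k)")
    case False
    let ?e0 = "mp_eval (\<lambda>c :: 'k. c) (Polynomial.coeff [:1, 0, 0:])"
    let ?e1 = "mp_eval (\<lambda>c :: 'k. c) (Polynomial.coeff [:0, 1, 0:])"
    have e0: "?e0 T \<noteq> 0"
      unfolding spec[OF comm_ring_hom_id] using False s by (intro monic_discriminant_binomial_0) auto
    have e1: "?e1 T \<noteq> 0"
      unfolding spec[OF comm_ring_hom_id] using False s by (intro monic_discriminant_binomial_1) auto
    have T: "T \<noteq> 0"
      using e0 by (auto simp: mp_eval_def)
    have "Polynomial.degree (grade d P) = 0 \<or> Polynomial.degree (grade d Q) = 0" if PQ: "D = P * Q" for P Q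
    proof -
      note PQ' = le[unfolded PQ] T[unfolded T_def PQ]
      have "?e0 (Polynomial.lead_coeff (grade d P)) \<noteq> 0" "?e1 (Polynomial.lead_coeff (grade d P)) \<noteq> 0"
        using mult[OF comm_ring_hom_id PQ'] e0 e1 unfolding T_def PQ by (metis mult_zero_left)+
      then have "d - 0 dvd Polynomial.degree (grade d P)" "d - 1 dvd Polynomial.degree (grade d P)"
        by (elim pure_power_dvd_degree_grade; simp add: coeff_pCons split: nat.splits)+
      then show ?thesis
        using coprime_dvd_product_cases[OF _ _ lead_coeff_grade_mult(1)[OF refl PQ']] s by simp
    qed
    then show ?thesis using T by blast
  next
    case True
    \<comment> \<open>Common form of the two degenerate cases: up to sign, the top part specializes
      to some \<open>E\<close> all of whose factorizations have a constant factor.\<close>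
    have "\<exists>x E. \<exists>u\<in>{1, - 1}. E \<noteq> 0 \<and> mp_eval ?c x T = u * E
      \<and> (\<forall>i. Polynomial.coeff (Polynomial.coeff (Polynomial.coeff (x i) 0) 0) 0 = 0)
      \<and> (\<forall>p q. p * q = E \<longrightarrow> (\<exists>\<kappa>. p = ?c \<kappa>) \<or> (\<exists>\<kappa>. q = ?c \<kappa>))"
    proof (cases "of_nat d = (0::'k)")
      case True
      let ?x = "Polynomial.coeff [:[:0, 1:], [:[:[:0, 1 :: 'k:]:]:], [:[:0, 1:]:]:]"
      obtain e0 \<alpha> n u where e: "u \<in> {1, - 1}" "\<alpha> \<noteq> 0" "Polynomial.coeff e0 0 \<noteq> 0"
        and eq: "monic_discriminant (Polynomial.monom 1 d + [:[:0, 1:], [:[:[:0, 1 :: 'k:]:]:], [:[:0, 1:]:]:])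
          = u * [:e0, Polynomial.monom [:\<alpha>:] n:]"
        using discriminant_linear_specialization[OF True d3 two] by blast
      show ?thesis
      proof (intro exI bexI conjI allI impI)
        show "[:e0, Polynomial.monom [:\<alpha>:] n:] \<noteq> 0" using e by auto
        show "mp_eval ?c ?x T = u * [:e0, Polynomial.monom [:\<alpha>:] n:]"
          unfolding spec[OF comm_ring_hom_triple_const] by (rule eq)
        show "(\<exists>\<kappa>. p = ?c \<kappa>) \<or> (\<exists>\<kappa>. q = ?c \<kappa>)" if "p * q = [:e0, Polynomial.monom [:\<alpha>:] n:]" for p q
          using that e(2,3) by (rule linear_factor_constant)
      qed (use e(1) in \<open>auto simp: coeff_pCons split: nat.splits\<close>)
    next
      case False
      let ?x = "Polynomial.coeff [:[:[:[:0, 1 :: 'k:]:]:], [:0, 1:], [:[:0, 1:]:]:]"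
      have "of_nat d = (1::'k)" using True False s by (simp add: of_nat_diff)
      then obtain e0 e1 \<alpha> n u where e: "u \<in> {1, - 1}" "\<alpha> \<noteq> 0" "Polynomial.coeff e0 0 \<noteq> 0"
          "odd (Polynomial.degree (e1\<^sup>2 - 4 * Polynomial.monom [:\<alpha>:] n * e0))"
        and eq: "monic_discriminant (Polynomial.monom 1 d + [:[:[:[:0, 1 :: 'k:]:]:], [:0, 1:], [:[:0, 1:]:]:])
          = u * [:e0, e1, Polynomial.monom [:\<alpha>:] n:]"
        using discriminant_quadratic_specialization[OF _ d4 two] by blast
      show ?thesis
      proof (intro exI bexI conjI allI impI)
        show "[:e0, e1, Polynomial.monom [:\<alpha>:] n:] \<noteq> 0" using e by auto
        show "mp_eval ?c ?x T = u * [:e0, e1, Polynomial.monom [:\<alpha>:] n:]"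
          unfolding spec[OF comm_ring_hom_triple_const] by (rule eq)
        show "(\<exists>\<kappa>. p = ?c \<kappa>) \<or> (\<exists>\<kappa>. q = ?c \<kappa>)" if "p * q = [:e0, e1, Polynomial.monom [:\<alpha>:] n:]" for p q
          using that e(2,3,4) by (rule quadratic_factor_constant)
      qed (use e(1) in \<open>auto simp: coeff_pCons split: nat.splits\<close>)
    qed
    then obtain x E u where u: "u \<in> {1, - 1}" and E: "E \<noteq> 0" and eq: "mp_eval ?c x T = u * E"
      and x: "\<And>i. Polynomial.coeff (Polynomial.coeff (Polynomial.coeff (x i) 0) 0) 0 = 0"
      and factor: "\<And>p q. p * q = E \<Longrightarrow> (\<exists>\<kappa>. p = ?c \<kappa>) \<or> (\<exists>\<kappa>. q = ?c \<kappa>)"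
      by blast
    have "mp_eval ?c x T \<noteq> 0" using eq u E by auto
    then have T: "T \<noteq> 0" by (auto simp: mp_eval_def)
    have "Polynomial.degree (grade d P) = 0 \<or> Polynomial.degree (grade d Q) = 0" if PQ: "D = P * Q" for P Q
    proof -
      note PQ' = le[unfolded PQ] T[unfolded T_def PQ]
      have "mp_eval ?c x (Polynomial.lead_coeff (grade d P)) * mp_eval ?c x (Polynomial.lead_coeff (grade d Q)) = u * E"
        using mult[OF comm_ring_hom_triple_const PQ', of x, folded PQ, folded T_def] unfolding eq .
      then show ?thesis using u E x factor by (rule constant_top_cases)
    qed
    then show ?thesis using T by blast
  qed
  then show ?thesis
    using le le_degree[of "grade d D" "d * (d - 1)"] unfolding T_def by auto
qed

text \<open>A nonzero factor whose top part has weight 0 is a constant, hence a unit; the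
  discriminant itself has positive weight d(d-1) and is neither 0 nor a unit.\<close>

theorem monic_discriminant_family_irreducible:
  fixes a :: "nat \<Rightarrow> 'k::field"
  assumes "(2::'k) \<noteq> 0" and "1 \<le> s" and "s + 3 \<le> d"
  shows "ring_irreducible\<^bsub>mp_ring (d - s)\<^esub> (monic_discriminant (family_poly d s a))"
proof -
  let ?R = "mp_ring (d - s) :: 'k multi_poly ring"
  define D where "D = monic_discriminant (family_poly d s a)"
  have D: "D \<in> carrier ?R" unfolding D_def by (rule discriminant_in_carrier)
  have degD: "Polynomial.degree (grade d D) = d * (d - 1)"
    using discriminant_factor_degree_grade_0[OF assms, of a] unfolding D_def by blast
  have factor: "Polynomial.degree (grade d P) = 0 \<or> Polynomial.degree (grade d Q) = 0" if "D = P * Q" for P Q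
    by (rule conjunct2[OF discriminant_factor_degree_grade_0[OF assms, of a], rule_format, OF that[unfolded D_def]])
  have pos: "0 < d * (d - 1)" using assms by simp
  interpret g: comm_ring_hom "grade d :: 'k multi_poly \<Rightarrow> _" by (rule comm_ring_hom_grade)
  have D0: "D \<noteq> 0" using degD pos by auto
  have ops: "monoid.mult ?R = (*)" "zero ?R = 0" "one ?R = 1"
    by (simp_all add: mp_ring_def ring_of_type_algebra_def)
  have unit: "p \<in> Units ?R" if p: "p \<in> carrier ?R" "Polynomial.degree (grade d p) = 0" "p \<noteq> 0" for p
  proof -
    obtain c where "p = mp_const c" using constant_if_degree_grade_0[OF p(1) _ p(2)] by auto
    moreover have "c \<noteq> 0" using p(3) calculation by (auto simp: mp_const_def)
    ultimately show ?thesis by (simp add: mp_const_Units)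
  qed
  interpret R: domain ?R by (rule domain_mp_ring)
  have not_unit: "D \<notin> Units ?R"
  proof
    assume "D \<in> Units ?R"
    then obtain q where "D * q = 1" unfolding Units_def ops by (auto simp: mult.commute)
    then have "grade d D * grade d q = 1" by (metis g.hom_mult g.hom_one)
    then have "Polynomial.degree (grade d D) = 0"
      by (metis degree_1 degree_mult_eq add_is_0 mult_zero_left mult_zero_right zero_neq_one)
    then show False using degD pos by simp
  qed
  have "b \<in> Units ?R" if b: "b \<in> carrier ?R" "properfactor ?R b D" for b
  proof -
    from b(2) obtain c where c: "c \<in> carrier ?R" "D = b * c" and nd: "\<not> D divides\<^bsub>?R\<^esub> b"
      unfolding properfactor_def factor_def ops by blast
    have nz: "b \<noteq> 0" "c \<noteq> 0" using D0 c(2) by auto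
    \<comment> \<open>Irreducibility is phrased by proper factors: if the cofactor were a unit,
      \<open>D\<close> would divide \<open>b\<close>.\<close>
    have "c \<notin> Units ?R"
    proof
      assume "c \<in> Units ?R"
      then obtain c' where "c' \<in> carrier ?R" "c * c' = 1" unfolding Units_def ops by auto
      then have "b = D * c'" using c(2) by (simp add: mult.assoc)
      then show False using nd \<open>c' \<in> carrier ?R\<close> unfolding factor_def ops by blast
    qed
    then show ?thesis using factor[OF c(2)] unit[OF b(1)] unit[OF c(1)] nz by blast
  qed
  then show ?thesis
    unfolding ring_irreducible_def Divisibility.irreducible_def ops D_def[symmetric]
    by (intro conjI ballI impI D0 not_unit) blast+
qed

theorem theoremA1:
  fixes a :: "nat \<Rightarrow> 'q::finite_field alg_closure"
    and d s :: nat
  assumes "CHAR('q) \<noteq> 2"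
    and "1 \<le> s" and "s + 3 \<le> d"
  shows "monic_discriminant (family_poly d s a) \<in> carrier (mp_ring (d - s))
       \<and> ring_irreducible\<^bsub>mp_ring (d - s)\<^esub> (monic_discriminant (family_poly d s a))"
proof -
  have "(2 :: 'q alg_closure) \<noteq> 0"
  proof
    assume "(2 :: 'q alg_closure) = 0"
    then have "of_nat 2 = (0 :: 'q alg_closure)" by simp
    \<comment> \<open>The algebraic closure has the characteristic of the base field, and
      characteristic 1 is impossible in a nonzero ring.\<close>
    then have "CHAR('q) dvd 2" unfolding of_nat_eq_0_iff_char_dvd by simp
    then have "CHAR('q) = 1 \<or> CHAR('q) = 2" using prime_nat_iff two_is_prime_nat by blast
    then show False using assms(1) by simp
  qed
  then show ?thesis
    using discriminant_in_carrier monic_discriminant_family_irreducible assms(2,3) by blast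
qed

end
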